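(* Let $p$ be a prime, let $a$ be a positive integer, and let $l,m,n\in\mathbb{N}$ with $m<p$ and $2\le n-l-m\le p$. Then for every $d\in\{1,\ldots,\max\{p^{a-2},1\}\}$, $$\frac{1}{p^{n-l}}\sum_{l<k\le n}\binom{p^an-p^{a-1}m-d}{p^ak-p^{a-1}m-d}(-1)^{pk}\binom{k-1}{l}\equiv\frac{(-1)^{l-1}n!/l!}{\prod_{k=0}^m(n-l-k)}B^{(m+1)}_{p-n+l+m}\pmod p.$$
   Context: For $m\in\mathbb{N}$ the $m$th order Bernoulli numbers $B^{(m)}_k$ are defined by $\left(\frac{x}{e^x-1}\right)^m=\sum_{k\ge0}B^{(m)}_k\frac{x^k}{k!}$. Congruences between rationals modulo $p$ mean the difference divided by $p$ is a $p$-adic integer. *)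

theory Defs
  imports "HOL-Computational_Algebra.Computational_Algebra"
begin

text \<open>
  Division in \<^typ>\<open>rat fps\<close> first cancels the common power of the indeterminate, so the
  quotient below is the power series of \<open>x / (e^x - 1)\<close>; see \<open>bernoulli_fps_mult\<close>.
\<close>
definition bernoulli_fps :: "rat fps" where
  "bernoulli_fps = fps_X / (fps_exp 1 - 1)"

definition bernoulli_higher :: "nat \<Rightarrow> nat \<Rightarrow> rat" where
  "bernoulli_higher m k = fact k * fps_nth (bernoulli_fps ^ m) k"

lemma bernoulli_fps_mult: "bernoulli_fps * (fps_exp 1 - 1) = fps_X"
proof -
  have nz: "fps_exp 1 - 1 \<noteq> (0 :: rat fps)"
  proof
    assume "fps_exp 1 - 1 = (0 :: rat fps)"
    then have "fps_nth (fps_exp 1 - 1 :: rat fps) 1 = 0" by simp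
    then show False by simp
  qed
  have "subdegree (fps_exp 1 - 1 :: rat fps) \<le> subdegree (fps_X :: rat fps)"
    by (simp add: subdegree_leI)
  with nz have "(fps_exp 1 - 1) dvd (fps_X :: rat fps)"
    by (subst fps_dvd_iff) auto
  then show ?thesis
    unfolding bernoulli_fps_def by (rule dvd_div_mult_self)
qed

text \<open>
  A rational number is a \<open>p\<close>-adic integer (\<open>p\<close> prime) iff \<open>p\<close> does not divide its denominator in
  lowest terms, which is the second component of \<^term>\<open>quotient_of x\<close>.
\<close>
definition padic_integer :: "nat \<Rightarrow> rat \<Rightarrow> bool" where
  "padic_integer p x \<longleftrightarrow> \<not> int p dvd snd (quotient_of x)"

definition rat_cong :: "rat \<Rightarrow> rat \<Rightarrow> nat \<Rightarrow> bool" where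
  "rat_cong x y p \<longleftrightarrow> padic_integer p ((x - y) / of_nat p)"

end

theory Submission
  imports Defs "HOL-Number_Theory.Residues"
begin

text \<open>
  Write \<open>q = p\<^sup>a\<close>, \<open>b = p\<^bsup>a-1\<^esup>\<close>, \<open>c = b m + d\<close>, \<open>D = n - l\<close> and \<open>\<epsilon> = (-1)\<^sup>p\<close>. Summing the generating function
  of the binomial coefficients shows that the sum in the theorem is \<open>\<epsilon>\<^bsup>l+1\<^esup>\<close> times the coefficient of
  \<open>x\<^bsup>q(D-1)\<^esup>\<close> in \<open>(1 - x)\<^bsup>c-1\<^esup> Q\<^bsup>-(l+1)\<^esup>\<close>, where \<open>Q = (1 - x)\<^sup>q - \<epsilon> x\<^sup>q = 1 + p A\<close> for a polynomial \<open>A\<close> of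
  degree less than \<open>q\<close> with integer coefficients. In the binomial expansion of \<open>(1 + p A)\<^bsup>-(l+1)\<^esup>\<close> the
  terms \<open>A\<^sup>i\<close> with \<open>i \<le> D - 2\<close> have too small a degree, the term with \<open>i = D - 1\<close> picks up an extra \<open>p\<^sup>2\<close>
  from the top coefficients of \<open>A\<close> (this is where \<open>d \<le> p\<^bsup>a-2\<^esup>\<close> enters), and the terms with \<open>i > D\<close> are
  divisible by \<open>p\<^bsup>D+1\<^esup>\<close>. The term with \<open>i = D\<close> is evaluated modulo \<open>p\<close>: \<open>A\<close> is congruent to
  \<open>- \<Sum>\<^bsub>0<j<p\<^esub> x\<^bsup>bj\<^esup> / j\<close>, so that one is left with a coefficient of a power of the truncated logarithm.
  Lagrange inversion along \<open>x = 1 - e\<^bsup>-u\<^esup>\<close> turns it into a coefficient of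
  \<open>(u / (e\<^sup>u - 1))\<^bsup>m+1\<^esup> (u / (1 - e\<^bsup>-u\<^esup>))\<^sup>p\<close>, whose second factor is 1 modulo \<open>p\<close> in the relevant range.
\<close>

subsection \<open>Power series identities\<close>

text \<open>Since \<open>W ^ i\<close> has order at least \<open>i\<close>, one cutoff
  \<open>n\<close> serves all terms of the Cauchy product, so the two sums can be
  interchanged.\<close>

lemma fps_mult_compose_nth:
  fixes F P W :: "'a::comm_ring_1 fps"
  assumes "W $ 0 = 0"
  shows "(P * (F oo W)) $ n = (\<Sum>i\<le>n. F $ i * (P * W ^ i) $ n)"
proof -
  have "(F oo W) $ (n - j) = (\<Sum>i\<le>n. F $ i * (W ^ i) $ (n - j))" for j
    unfolding fps_compose_nth
    by (rule sum.mono_neutral_left) (auto simp: assms startsby_zero_power_prefix)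
  then have "(P * (F oo W)) $ n = (\<Sum>j=0..n. \<Sum>i\<le>n. F $ i * (P $ j * (W ^ i) $ (n - j)))"
    by (simp add: fps_mult_nth sum_distrib_left mult_ac)
  also have "\<dots> = (\<Sum>i\<le>n. \<Sum>j=0..n. F $ i * (P $ j * (W ^ i) $ (n - j)))"
    by (rule sum.swap)
  finally show ?thesis by (simp add: fps_mult_nth sum_distrib_left)
qed

lemma one_minus_fps_X_power_nth:
  "((1 - fps_X) ^ n :: 'a::comm_ring_1 fps) $ k = (- 1) ^ k * of_nat (n choose k)"
proof (induction n arbitrary: k)
  case 0
  then show ?case by (cases k) auto
next
  case (Suc n)
  show ?case
  proof (cases k)
    case 0
    then show ?thesis by (simp add: fps_mult_nth fps_power_zeroth)
  next
    case (Suc k')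
    then show ?thesis
      using Suc.IH by (simp add: left_diff_distrib algebra_simps)
  qed
qed

section \<open>Negative binomial series and the generating function of the sum\<close>

text \<open>This is (1 - x)^(-(l+1)), given by its coefficients so that no division in the
  coefficient ring is required.\<close>

definition neg_binomial_fps :: "nat \<Rightarrow> 'a::comm_ring_1 fps" where
  "neg_binomial_fps l = Abs_fps (\<lambda>i. of_nat ((l + i) choose l))"

text \<open>Multiplication by \<open>1 - fps_X\<close> takes differences of consecutive
  coefficients; by Pascal's rule this lowers \<open>l\<close> by one.\<close>

lemma neg_binomial_fps_mult: "neg_binomial_fps l * (1 - fps_X) ^ (l + 1) = 1"
proof (induction l)
  case 0
  have "neg_binomial_fps 0 * (1 - fps_X) = (1 :: 'a fps)"
  proof (rule fps_ext)
    fix k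
    show "(neg_binomial_fps 0 * (1 - fps_X) :: 'a fps) $ k = 1 $ k"
      by (cases k) (simp_all add: neg_binomial_fps_def right_diff_distrib)
  qed
  then show ?case by simp
next
  case (Suc l)
  have "neg_binomial_fps (Suc l) * (1 - fps_X) = (neg_binomial_fps l :: 'a fps)"
  proof (rule fps_ext)
    fix k
    show "(neg_binomial_fps (Suc l) * (1 - fps_X) :: 'a fps) $ k = neg_binomial_fps l $ k"
      by (cases k) (simp_all add: neg_binomial_fps_def right_diff_distrib binomial_eq_0)
  qed
  with Suc show ?case by (simp add: mult_ac)
       (metis mult.assoc mult.commute)
qed

text \<open>As \<open>J\<close> is 1/(1 - x), cancelling \<open>c - 1\<close> of the
  \<open>q * k\<close> factors \<open>J\<close> leaves \<epsilon>^k x^(qk) (1 - x)^(-(K+1)) with K =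
  qk - c, a shifted negative binomial series.\<close>

lemma binomial_eq_fps_nth:
  fixes J :: "'a::idom fps"
  assumes J: "J * (1 - fps_X) = 1" and "c \<ge> 1" "c \<le> q * k" "k \<le> n"
  shows "((1 - fps_X) ^ (c - 1) * (fps_const \<epsilon> * fps_X ^ q * J ^ q) ^ k) $ (q * n)
     = of_nat ((q * n - c) choose (q * k - c)) * \<epsilon> ^ k"
proof -
  define K where "K = q * k - c"
  have "neg_binomial_fps K * (1 - fps_X) ^ (K + 1) = J ^ (K + 1) * (1 - fps_X) ^ (K + 1)"
    using neg_binomial_fps_mult[of K, where 'a = 'a] J
    by (simp only: flip: power_mult_distrib) simp
  moreover have "1 - fps_X \<noteq> (0 :: 'a fps)"
    using J by auto
  ultimately have nb: "J ^ (K + 1) = neg_binomial_fps K"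
    by simp
  have "q * k = (K + 1) + (c - 1)" using assms by (simp add: K_def)
  then have "J ^ (q * k) = J ^ (K + 1) * J ^ (c - 1)"
    by (simp add: power_add)
  then have "(1 - fps_X) ^ (c - 1) * J ^ (q * k) = neg_binomial_fps K * (J * (1 - fps_X)) ^ (c - 1)"
    unfolding power_mult_distrib nb[symmetric] by (simp only: mult_ac)
  then have *: "(1 - fps_X) ^ (c - 1) * J ^ (q * k) = neg_binomial_fps K"
    using J by simp
  have "(1 - fps_X) ^ (c - 1) * (fps_const \<epsilon> * fps_X ^ q * J ^ q) ^ k
      = fps_const (\<epsilon> ^ k) * (fps_X ^ (q * k) * neg_binomial_fps K)"
    unfolding *[symmetric] fps_const_power[symmetric] power_mult_distrib power_mult
    by (simp only: mult_ac)
  moreover have "\<not> q * n < q * k" "K + (q * n - q * k) = q * n - c"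
    using assms by (auto simp: K_def not_less)
  ultimately show ?thesis
    by (simp only: fps_mult_left_const_nth fps_X_power_mult_nth if_False)
       (simp add: neg_binomial_fps_def K_def)
qed

text \<open>The weights binom(k-1, l) are the coefficients of F = (x/(1 - x))^(l+1), so the sum is a
  coefficient of (1 - x)^(c-1) F(W) with W = \<epsilon> x^q/(1 - x)^q. Since 1 - W = Q/(1 - x)^q,
  the composition F(W) equals \<epsilon>^(l+1) x^(q(l+1)) Q^(-(l+1)). The bound
  \<open>c \<le> q\<close> keeps the subtraction \<open>q * k - c\<close> from truncating.\<close>

lemma binomial_sum_eq_fps_nth:
  fixes Q V :: "'a::idom fps"
  assumes "c \<ge> 1" "c \<le> q" "q \<ge> 1" "l < n"
    and Q: "Q = (1 - fps_X) ^ q - fps_const \<epsilon> * fps_X ^ q"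
    and V: "V * Q ^ (l + 1) = 1"
  shows "(\<Sum>k\<in>{l<..n}. of_nat ((q * n - c) choose (q * k - c)) * \<epsilon> ^ k * of_nat ((k - 1) choose l))
     = \<epsilon> ^ (l + 1) * ((1 - fps_X) ^ (c - 1) * V) $ (q * (n - l - 1))"
proof -
  define J :: "'a fps" where "J = neg_binomial_fps 0"
  have J: "J * (1 - fps_X) = 1"
    using neg_binomial_fps_mult[of 0, where 'a = 'a] by (simp add: J_def)
  define W where "W = fps_const \<epsilon> * fps_X ^ q * J ^ q"
  define F :: "'a fps" where "F = fps_X ^ (l + 1) * neg_binomial_fps l"
  have W0: "W $ 0 = 0"
    using \<open>q \<ge> 1\<close> by (simp add: W_def fps_mult_nth)
  have "W * (1 - fps_X) ^ q = fps_const \<epsilon> * fps_X ^ q * (J * (1 - fps_X)) ^ q"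
    by (simp add: W_def power_mult_distrib mult_ac)
  then have Q': "(1 - W) * (1 - fps_X) ^ q = Q"
    by (simp add: Q J left_diff_distrib)
  define U where "U = neg_binomial_fps l oo W"
  have "U * (1 - W) ^ (l + 1) = (neg_binomial_fps l * (1 - fps_X) ^ (l + 1)) oo W"
    unfolding U_def fps_compose_mult_distrib[OF W0]
    by (simp add: W0 fps_compose_mult_distrib fps_compose_power fps_compose_sub_distrib flip: fps_compose_power)
  then have U: "U * (1 - W) ^ (l + 1) = 1"
    using neg_binomial_fps_mult[of l, where 'a = 'a] by simp
  have "U = U * (V * Q ^ (l + 1))" using V by simp
  also have "\<dots> = V * (1 - fps_X) ^ (q * (l + 1)) * (U * (1 - W) ^ (l + 1))"
    unfolding Q'[symmetric] power_mult_distrib power_mult by (simp only: mult_ac)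
  finally have U': "U = V * (1 - fps_X) ^ (q * (l + 1))"
    by (simp only: U mult_1_right)
  have "F oo W = W ^ (l + 1) * U"
    by (simp add: F_def U_def W0 fps_compose_mult_distrib fps_compose_power[OF W0, symmetric])
  also have "\<dots> = fps_const (\<epsilon> ^ (l + 1)) * fps_X ^ (q * (l + 1)) * V * (J * (1 - fps_X)) ^ (q * (l + 1))"
    unfolding U' W_def power_mult_distrib power_mult fps_const_power[symmetric]
    by (simp only: mult_ac)
  finally have FW: "F oo W = fps_const (\<epsilon> ^ (l + 1)) * fps_X ^ (q * (l + 1)) * V"
    using J by simp
  have FW0: "(1 - fps_X) ^ (c - 1) * (F oo W)
      = fps_const (\<epsilon> ^ (l + 1)) * (fps_X ^ (q * (l + 1)) * ((1 - fps_X) ^ (c - 1) * V))"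
    unfolding FW by (simp only: mult_ac)
  have le: "\<not> q * n < q * (l + 1)" "q * n - q * (l + 1) = q * (n - l - 1)"
    using \<open>l < n\<close> by (simp_all only: not_less mult_le_mono2 flip: diff_mult_distrib2) auto
  have "\<epsilon> ^ (l + 1) * ((1 - fps_X) ^ (c - 1) * V) $ (q * (n - l - 1))
      = ((1 - fps_X) ^ (c - 1) * (F oo W)) $ (q * n)"
    unfolding FW0 using le by (simp only: fps_mult_left_const_nth fps_X_power_mult_nth if_False)
  also have "\<dots> = (\<Sum>i\<le>q * n. F $ i * ((1 - fps_X) ^ (c - 1) * W ^ i) $ (q * n))"
    by (rule fps_mult_compose_nth[OF W0])
  also have "\<dots> = (\<Sum>i\<in>{l<..n}. F $ i * ((1 - fps_X) ^ (c - 1) * W ^ i) $ (q * n))"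
  proof (rule sum.mono_neutral_right)
    show "{l<..n} \<subseteq> {..q * n}" using \<open>q \<ge> 1\<close> by (auto intro: order.trans[OF _ mult_le_mono1[of 1 q n]])
    show "\<forall>i\<in>{..q * n} - {l<..n}. F $ i * ((1 - fps_X) ^ (c - 1) * W ^ i) $ (q * n) = 0"
    proof
      fix i assume "i \<in> {..q * n} - {l<..n}"
      \<comment> \<open>Below \<open>l + 1\<close> the coefficient of \<open>F\<close> is zero;
        above \<open>n\<close> the order \<open>q * i\<close> of \<open>W ^ i\<close> exceeds
        \<open>q * n\<close>.\<close>
      then consider "i \<le> l" | "n < i" by fastforce
      then show "F $ i * ((1 - fps_X) ^ (c - 1) * W ^ i) $ (q * n) = 0"
      proof cases
        case 1
        then show ?thesis by (simp add: F_def fps_X_power_mult_nth del: power_Suc)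
      next
        case 2
        have "(1 - fps_X) ^ (c - 1) * W ^ i
            = fps_X ^ (q * i) * ((1 - fps_X) ^ (c - 1) * fps_const (\<epsilon> ^ i) * J ^ (q * i))"
          unfolding W_def fps_const_power[symmetric] power_mult_distrib power_mult
          by (simp only: mult_ac)
        moreover have "q * n < q * i" using 2 \<open>q \<ge> 1\<close> by simp
        ultimately show ?thesis
          by (simp only: fps_X_power_mult_nth if_True mult_zero_right)
      qed
    qed
  qed auto
  also have "\<dots> = (\<Sum>k\<in>{l<..n}. of_nat ((q * n - c) choose (q * k - c)) * \<epsilon> ^ k * of_nat ((k - 1) choose l))"
  proof (rule sum.cong)
    fix k assume k: "k \<in> {l<..n}"
    then have "c \<le> q * k"
      using \<open>c \<le> q\<close> by (auto intro: order.trans[OF _ mult_le_mono2[of 1 k q]])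
    moreover have "F $ k = of_nat ((k - 1) choose l)"
      using k by (simp add: F_def fps_X_power_mult_nth neg_binomial_fps_def del: power_Suc)
    ultimately show "F $ k * ((1 - fps_X) ^ (c - 1) * W ^ k) $ (q * n)
        = of_nat ((q * n - c) choose (q * k - c)) * \<epsilon> ^ k * of_nat ((k - 1) choose l)"
      using binomial_eq_fps_nth[OF J \<open>c \<ge> 1\<close>, of q k n \<epsilon>] k by (simp add: W_def)
  qed simp
  finally show ?thesis by simp
qed

text \<open>The binomial series of (1 + xA)^(-(l+1)), obtained by substituting -xA into
  \<open>neg_binomial_fps l\<close>.\<close>

lemma inverse_power_expansion:
  fixes A P :: "'a::idom fps"
  assumes "A $ 0 = 0"
  obtains V where "V * (1 + fps_const x * A) ^ (l + 1) = 1"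
    and "\<And>P M. (P * V) $ M = (\<Sum>i\<le>M. of_nat ((l + i) choose l) * (- x) ^ i * (P * A ^ i) $ M)"
proof
  define W where "W = fps_const (- x) * A"
  have W0: "W $ 0 = 0" by (simp add: W_def assms)
  define V where "V = neg_binomial_fps l oo W"
  have "V * (1 - W) ^ (l + 1) = (neg_binomial_fps l * (1 - fps_X) ^ (l + 1)) oo W"
    unfolding V_def fps_compose_mult_distrib[OF W0]
    by (simp add: W0 fps_compose_mult_distrib fps_compose_power fps_compose_sub_distrib flip: fps_compose_power)
  moreover have "1 - W = 1 + fps_const x * A"
    by (simp add: W_def flip: fps_const_neg)
  ultimately show "V * (1 + fps_const x * A) ^ (l + 1) = 1"
    using neg_binomial_fps_mult[of l, where 'a = 'a] by simp
  have "(P * W ^ i) $ M = (- x) ^ i * (P * A ^ i) $ M" for P M i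
  proof -
    have PW: "P * W ^ i = fps_const ((- x) ^ i) * (P * A ^ i)"
      unfolding W_def power_mult_distrib fps_const_power by (simp only: mult_ac)
    show ?thesis unfolding PW by simp
  qed
  then show "(P * V) $ M = (\<Sum>i\<le>M. of_nat ((l + i) choose l) * (- x) ^ i * (P * A ^ i) $ M)" for P M
    unfolding V_def fps_mult_compose_nth[OF W0] by (simp add: neg_binomial_fps_def mult_ac)
qed

text \<open>The signed analogue of palindromic polynomials of formal degree \<open>n\<close>.\<close>

definition reciprocal :: "'a::comm_ring_1 \<Rightarrow> nat \<Rightarrow> 'a fps \<Rightarrow> bool" where
  "reciprocal s n F \<longleftrightarrow> (\<forall>k>n. F $ k = 0) \<and> (\<forall>k\<le>n. F $ (n - k) = s * F $ k)"

text \<open>Bounding both indices gives a set of pairs on which the reflection (i, j) -> (n - i, m -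
  j) acts, as \<open>reciprocal_mult\<close> requires.\<close>

lemma fps_mult_nth_bounded:
  fixes F G :: "'a::comm_ring_1 fps"
  assumes "\<forall>k>n. F $ k = 0" "\<forall>k>m. G $ k = 0"
  shows "(F * G) $ t = (\<Sum>(i, j)\<in>{(i, j). i \<le> n \<and> j \<le> m \<and> i + j = t}. F $ i * G $ j)"
proof -
  have "(F * G) $ t = (\<Sum>(i, j)\<in>{(i, j). i + j = t}. F $ i * G $ j)"
    unfolding fps_mult_nth
    by (rule sum.reindex_bij_witness[of _ fst "\<lambda>i. (i, t - i)"]) auto
  also have "\<dots> = (\<Sum>(i, j)\<in>{(i, j). i \<le> n \<and> j \<le> m \<and> i + j = t}. F $ i * G $ j)"
  proof (rule sum.mono_neutral_right)
    show "finite {(i, j). i + j = t}"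
      by (rule finite_subset[of _ "{..t} \<times> {..t}"]) auto
    show "\<forall>x\<in>{(i, j). i + j = t} - {(i, j). i \<le> n \<and> j \<le> m \<and> i + j = t}.
        (case x of (i, j) \<Rightarrow> F $ i * G $ j) = 0"
    proof
      fix x assume x: "x \<in> {(i, j). i + j = t} - {(i, j). i \<le> n \<and> j \<le> m \<and> i + j = t}"
      obtain i j where [simp]: "x = (i, j)" by force
      from x have "n < i \<or> m < j" by auto
      then show "(case x of (i, j) \<Rightarrow> F $ i * G $ j) = 0"
        using assms by auto
    qed
  qed auto
  finally show ?thesis .
qed

lemma reciprocal_mult:
  assumes F: "reciprocal s n F" and G: "reciprocal t m G"
  shows "reciprocal (s * t) (n + m) (F * G)"
proof -
  have F0: "\<forall>k>n. F $ k = 0" and G0: "\<forall>k>m. G $ k = 0"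
    and F1: "\<And>k. k \<le> n \<Longrightarrow> F $ (n - k) = s * F $ k"
    and G1: "\<And>k. k \<le> m \<Longrightarrow> G $ (m - k) = t * G $ k"
    using assms by (auto simp: reciprocal_def)
  note nth = fps_mult_nth_bounded[OF F0 G0]
  have "(F * G) $ k = 0" if "k > n + m" for k
  proof -
    have "{(i, j). i \<le> n \<and> j \<le> m \<and> i + j = k} = {}" using that by auto
    then show ?thesis by (simp only: nth sum.empty)
  qed
  moreover have "(F * G) $ (n + m - k) = s * t * (F * G) $ k" if "k \<le> n + m" for k
  proof -
    have "(F * G) $ (n + m - k)
        = (\<Sum>(i, j)\<in>{(i, j). i \<le> n \<and> j \<le> m \<and> i + j = k}. F $ (n - i) * G $ (m - j))"
      unfolding nth
      by (rule sum.reindex_bij_witness[of _ "\<lambda>(i, j). (n - i, m - j)" "\<lambda>(i, j). (n - i, m - j)"])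
         (use that in auto)
    also have "\<dots> = (\<Sum>(i, j)\<in>{(i, j). i \<le> n \<and> j \<le> m \<and> i + j = k}. s * t * (F $ i * G $ j))"
      by (rule sum.cong) (auto simp: F1 G1)
    also have "\<dots> = s * t * (F * G) $ k"
      unfolding nth sum_distrib_left by (simp add: case_prod_unfold)
    finally show ?thesis .
  qed
  ultimately show ?thesis by (auto simp: reciprocal_def)
qed

lemma reciprocal_power:
  assumes "reciprocal s n F"
  shows "reciprocal (s ^ k) (n * k) (F ^ k)"
proof (induction k)
  case 0
  then show ?case by (simp add: reciprocal_def)
next
  case (Suc k)
  then show ?case using reciprocal_mult[OF assms Suc] by simp
qed

lemma reciprocal_one_minus_X: "reciprocal (- 1) 1 (1 - fps_X :: 'a::comm_ring_1 fps)"
  by (auto simp: reciprocal_def le_Suc_eq fps_X_def)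

section \<open>Orders of vanishing and substitution of a power of the indeterminate\<close>

text \<open>Unlike a lower bound on \<open>subdegree\<close>, this holds for the zero series and is
  therefore stable under addition.\<close>

definition vanishes_below :: "nat \<Rightarrow> 'a::zero fps \<Rightarrow> bool" where
  "vanishes_below n F \<longleftrightarrow> (\<forall>k<n. F $ k = 0)"

lemma vanishes_below_add:
  "vanishes_below n F \<Longrightarrow> vanishes_below n G \<Longrightarrow> vanishes_below n (F + G)" for F :: "'a::comm_ring_1 fps"
  by (simp add: vanishes_below_def)

lemma vanishes_below_mult:
  fixes F G :: "'a::comm_ring_1 fps"
  assumes "vanishes_below n F" "vanishes_below m G"
  shows "vanishes_below (n + m) (F * G)"
  unfolding vanishes_below_def fps_mult_nth
proof (intro allI impI sum.neutral ballI)
  fix k i assume "k < n + m" "i \<in> {0..k}"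
  then have "i < n \<or> k - i < m" by auto
  then show "F $ i * G $ (k - i) = 0"
    using assms by (auto simp: vanishes_below_def)
qed

lemma fps_power_nth_cong:
  fixes F G :: "'a::comm_ring_1 fps"
  assumes "\<And>k. k \<le> N \<Longrightarrow> F $ k = G $ k" "j \<le> N"
  shows "(F ^ i) $ j = (G ^ i) $ j"
  using assms(2)
proof (induction i arbitrary: j)
  case (Suc i)
  then show ?case by (simp add: fps_mult_nth assms(1))
qed simp

text \<open>Only exponents divisible by \<open>b\<close> occur in G(x^b), and the other factor has
  degree \<open>e < b\<close>. Hence degree \<open>b * t + e\<close> is reached only by the top
  coefficient (-1)^e together with \<open>G $ t\<close>.\<close>

lemma one_minus_X_power_mult_compose_nth:
  fixes G :: "'a::comm_ring_1 fps"
  assumes "e < b"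
  shows "((1 - fps_X) ^ e * (G oo fps_X ^ b)) $ (b * t + e) = (- 1) ^ e * G $ t"
proof -
  have "((1 - fps_X) ^ e * (G oo fps_X ^ b)) $ (b * t + e)
      = (\<Sum>i=0..b * t + e. if i = e then (- 1) ^ e * G $ t else 0)"
    unfolding fps_mult_nth
  proof (rule sum.cong)
    fix i assume i: "i \<in> {0..b * t + e}"
    show "((1 - fps_X) ^ e) $ i * (G oo fps_X ^ b) $ (b * t + e - i)
        = (if i = e then (- 1) ^ e * G $ t else 0)"
    proof (cases "i < e")
      case True
      then have "b * t + e - i = b * t + (e - i)" by simp
      moreover have "\<not> b dvd (e - i)"
        using True assms by (auto dest: dvd_imp_le)
      ultimately have "\<not> b dvd (b * t + e - i)"
        by (metis dvd_triv_left dvd_add_right_iff)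
      then show ?thesis using True by (simp add: fps_nth_compose_X_power)
    next
      case False
      then show ?thesis
        using assms by (auto simp: one_minus_fps_X_power_nth fps_nth_compose_X_power binomial_eq_0)
    qed
  qed simp
  then show ?thesis by simp
qed

subsection \<open>Lagrange inversion\<close>

text \<open>With \<phi> = x\<psi> the right side is the residue of F(\<phi>) \<phi>' / \<phi>^(E+1).
  By linearity it suffices to treat F = x^j: for j = E the residue is 1, and for j < E the form
  \<phi>^(j-E-1) \<phi>' is an exact derivative.\<close>

lemma lagrange_inversion:
  fixes F \<psi> :: "'a::field_char_0 fps"
  assumes "\<psi> $ 0 = 1"
  shows "F $ E = ((F oo (fps_X * \<psi>)) * (fps_deriv (fps_X * \<psi>) * inverse \<psi> ^ (E + 1))) $ E"
proof -
  define \<phi> where "\<phi> = fps_X * \<psi>"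
  have \<phi>0: "\<phi> $ 0 = 0" by (simp add: \<phi>_def)
  have inv: "\<psi> * inverse \<psi> = 1" using assms by (metis inverse_mult_eq_1' one_neq_zero)
  define P where "P = fps_deriv \<phi> * inverse \<psi> ^ (E + 1)"
  have *: "(P * \<phi> ^ j) $ E = (if j = E then 1 else 0)" if "j \<le> E" for j
  proof -
    define r where "r = E - j"
    have E: "E = j + r" using that by (simp add: r_def)
    have "P * \<phi> ^ j = fps_X ^ j * (fps_deriv \<phi> * (inverse \<psi> ^ (r + 1)) * (\<psi> * inverse \<psi>) ^ j)"
      by (simp add: P_def E \<phi>_def power_mult_distrib power_add mult_ac)
    then have "(P * \<phi> ^ j) $ E = (fps_deriv \<phi> * inverse \<psi> ^ (r + 1)) $ r"
      by (simp add: inv fps_X_power_mult_nth E)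
    also have "\<dots> = (if r = 0 then 1 else 0)"
    proof (cases "r = 0")
      case True
      then show ?thesis using assms by (simp add: \<phi>_def fps_mult_nth)
    next
      case False
      \<comment> \<open>Exactness without Laurent series: \<phi>' \<psi>^(-(r+1)) = \<chi> + x Z,
        while \<chi>' = -r Z. Comparing coefficients in degree r - 1 and dividing by r, which is
        nonzero in characteristic zero, makes the coefficient of x^r vanish.\<close>
      define \<chi> where "\<chi> = inverse \<psi> ^ r"
      have d\<phi>: "fps_deriv \<phi> * inverse \<psi> ^ (r + 1)
          = \<chi> * (\<psi> * inverse \<psi>) + fps_X * (fps_deriv \<psi> * inverse \<psi> ^ (r + 1))"
        by (simp add: \<phi>_def \<chi>_def algebra_simps)
      have d: "fps_deriv (inverse \<psi>) = - (fps_deriv \<psi> * inverse \<psi> ^ 2)"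
        using assms by (subst fps_inverse_deriv) auto
      obtain s where s: "r = Suc s" using False by (cases r) auto
      define Z where "Z = fps_deriv \<psi> * inverse \<psi> ^ (r + 1)"
      have "fps_deriv \<chi> = fps_const (of_nat r) * fps_deriv (inverse \<psi>) * inverse \<psi> ^ s"
        by (simp only: \<chi>_def s fps_deriv_power diff_Suc_1)
      also have "\<dots> = - (fps_const (of_nat r) * (fps_deriv \<psi> * (inverse \<psi> ^ 2 * inverse \<psi> ^ s)))"
        by (simp only: d mult.assoc mult_minus_left mult_minus_right)
      also have "inverse \<psi> ^ 2 * inverse \<psi> ^ s = inverse \<psi> ^ (r + 1)"
        by (simp only: s flip: power_add) simp
      finally have "fps_deriv \<chi> = - (fps_const (of_nat r) * Z)"
        by (simp only: Z_def)
      then have "(fps_deriv \<chi>) $ s = - (of_nat r * Z $ s)"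
        by (simp only: fps_mult_left_const_nth fps_neg_nth)
      then have "of_nat r * \<chi> $ r = of_nat r * (- (Z $ s))"
        by (simp only: fps_deriv_nth s Suc_eq_plus1 mult_minus_right)
      moreover have "of_nat r \<noteq> (0 :: 'a)" by (simp only: of_nat_eq_0_iff False not_False_eq_True)
      ultimately have "\<chi> $ r = - (Z $ s)"
        using mult_left_cancel by blast
      then have "(\<chi> * 1 + fps_X * Z) $ r = 0"
        by (simp only: mult_1_right fps_add_nth fps_X_mult_nth False if_False)
           (simp add: s)
      then show ?thesis
        unfolding d\<phi> inv Z_def[symmetric] by (simp only: False if_False)
    qed
    finally show ?thesis using that by (auto simp: r_def)
  qed
  have "(P * (F oo \<phi>)) $ E = (\<Sum>i\<le>E. F $ i * (if i = E then 1 else 0))"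
    unfolding fps_mult_compose_nth[OF \<phi>0] by (rule sum.cong) (simp_all add: *)
  also have "\<dots> = F $ E"
    by (subst sum.remove[of _ E]) auto
  finally have "(P * (F oo \<phi>)) $ E = F $ E" .
  then show ?thesis
    by (simp add: P_def \<phi>_def mult.commute)
qed

text \<open>Here x\<psi> = 1 - e^(-x) = \<phi>, and the series raised to the power \<open>D\<close>
  is T = -log(1 - x)/x. Substituting \<phi> turns 1 - x into e^(-x) and T into 1/\<psi>; with
  \<phi>' = e^(-x), Lagrange inversion gives the first claim. The second is x/(1 - e^(-x)) = x
  e^x/(e^x - 1).\<close>

lemma bernoulli_fps_lagrange:
  fixes \<psi> :: "rat fps"
  defines "\<psi> \<equiv> Abs_fps (\<lambda>k. (- 1) ^ k / fact (k + 1))"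
  shows "((1 - fps_X) ^ m * Abs_fps (\<lambda>k. 1 / of_nat (k + 1)) ^ D) $ E
       = (fps_exp (- of_nat (m + 1)) * inverse \<psi> ^ (D + E + 1)) $ E"
    and "bernoulli_fps * fps_exp 1 = inverse \<psi>"
proof -
  define \<phi> :: "rat fps" where "\<phi> = fps_X * \<psi>"
  define T :: "rat fps" where "T = Abs_fps (\<lambda>k. 1 / of_nat (k + 1))"
  have \<psi>0: "\<psi> $ 0 = 1" by (simp add: \<psi>_def)
  have inv: "\<psi> * inverse \<psi> = 1" using \<psi>0 by (metis inverse_mult_eq_1' one_neq_zero)
  have \<phi>: "\<phi> = 1 - fps_exp (- 1)"
  proof (rule fps_ext)
    fix k show "\<phi> $ k = (1 - fps_exp (- 1)) $ k"
      by (cases k) (simp_all add: \<phi>_def \<psi>_def algebra_simps)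
  qed
  have \<phi>0: "\<phi> $ 0 = 0" by (simp add: \<phi>_def)
  have e: "fps_exp 1 * fps_exp (- 1) = (1 :: rat fps)"
    by (simp flip: fps_exp_add_mult)
  have "fps_deriv (fps_X * T) * (1 - fps_X) = 1"
  proof (rule fps_ext)
    fix k show "(fps_deriv (fps_X * T) * (1 - fps_X)) $ k = 1 $ k"
      by (cases k) (simp_all add: T_def right_diff_distrib del: fps_deriv_mult of_nat_Suc)
  qed
  \<comment> \<open>The logarithm is inverted by differentiation: (xT) composed with \<phi> has
    derivative \<phi>'/(1 - \<phi>) = 1 and no constant term, so it is x.\<close>
  then have "(fps_deriv (fps_X * T) oo \<phi>) * ((1 - fps_X) oo \<phi>) = 1"
    by (metis fps_compose_1 fps_compose_mult_distrib \<phi>0)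
  moreover have d\<phi>: "fps_deriv \<phi> = fps_exp (- 1)" "(1 - fps_X) oo \<phi> = fps_exp (- 1)"
    by (simp_all add: \<phi> fps_compose_sub_distrib fps_eq_iff)
  ultimately have "fps_deriv ((fps_X * T) oo \<phi>) = 1"
    by (metis fps_compose_deriv \<phi>0)
  then have "fps_deriv ((fps_X * T) oo \<phi>) = fps_deriv fps_X" by simp
  then have "(fps_X * T) oo \<phi> = fps_X"
    by (subst (asm) fps_deriv_eq_iff) simp
  then have "fps_X * (\<psi> * (T oo \<phi>)) = fps_X * 1"
    by (simp add: fps_compose_mult_distrib \<phi>0) (simp add: \<phi>_def mult_ac)
  then have "\<psi> * (T oo \<phi>) = 1" by (simp only: mult_left_cancel fps_X_neq_zero not_False_eq_True) 
  then have T: "T oo \<phi> = inverse \<psi>"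
    by (rule fps_inverse_unique[symmetric])
  have exp: "fps_exp (- 1) ^ k = (fps_exp (- of_nat k) :: rat fps)" for k
    by (simp add: fps_exp_power_mult)
  have "((1 - fps_X) ^ m * T ^ D) oo \<phi> = fps_exp (- 1) ^ m * inverse \<psi> ^ D"
    by (simp add: fps_compose_mult_distrib \<phi>0 d\<phi> T flip: fps_compose_power)
  then show "((1 - fps_X) ^ m * Abs_fps (\<lambda>k. 1 / of_nat (k + 1)) ^ D) $ E
       = (fps_exp (- of_nat (m + 1)) * inverse \<psi> ^ (D + E + 1)) $ E"
    unfolding exp[symmetric] T_def[symmetric]
    by (subst lagrange_inversion[OF \<psi>0])
       (simp add: d\<phi>(1) power_add mult_ac flip: \<phi>_def)
  have "fps_X * (\<psi> * (bernoulli_fps * fps_exp 1)) = bernoulli_fps * (fps_exp 1 * \<phi>)"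
    by (simp add: \<phi>_def mult_ac)
  also have "fps_exp 1 * \<phi> = fps_exp 1 - 1"
    using e by (simp add: \<phi> right_diff_distrib)
  finally have "fps_X * (\<psi> * (bernoulli_fps * fps_exp 1)) = fps_X * 1"
    by (simp add: bernoulli_fps_mult)
  then have "\<psi> * (bernoulli_fps * fps_exp 1) = 1"
    by (simp only: mult_left_cancel fps_X_neq_zero not_False_eq_True)
  then show "bernoulli_fps * fps_exp 1 = inverse \<psi>"
    using fps_inverse_unique by metis
qed

subsection \<open>Rational numbers and power series modulo powers of a prime\<close>

text \<open>Frees the notion from lowest terms, which sums and products do not preserve: the reduced
  denominator divides every denominator.\<close>

lemma padic_integer_iff:
  assumes "prime p"
  shows "padic_integer p x \<longleftrightarrow> (\<exists>a b. x = of_int a / of_int b \<and> \<not> int p dvd b)"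
proof
  assume "padic_integer p x"
  moreover obtain a b where ab: "quotient_of x = (a, b)" by force
  ultimately show "\<exists>a b. x = of_int a / of_int b \<and> \<not> int p dvd b"
    using quotient_of_div[OF ab] by (auto simp: padic_integer_def)
next
  assume "\<exists>a b. x = of_int a / of_int b \<and> \<not> int p dvd b"
  then obtain a b where x: "x = of_int a / of_int b" and b: "\<not> int p dvd b" by blast
  obtain c d where cd: "quotient_of x = (c, d)" by force
  have d: "d > 0" using quotient_of_denom_pos[OF cd] .
  have "x = of_int c / of_int d" using quotient_of_div[OF cd] .
  moreover have "b \<noteq> 0" using b by auto
  ultimately have "of_int (a * d) = (of_int (c * b) :: rat)"
    using x d by (simp add: field_simps)
  then have "a * d = c * b" by (simp only: of_int_eq_iff)
  then have "d dvd c * b" by (metis dvd_triv_right)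
  moreover have "coprime d c"
    using quotient_of_coprime[OF cd] by (simp add: coprime_commute)
  ultimately have "d dvd b" by (simp add: coprime_dvd_mult_right_iff)
  with b show "padic_integer p x"
    by (auto simp: padic_integer_def cd dest: dvd_trans)
qed

locale padic =
  fixes p :: nat
  assumes prime: "prime p"
begin

lemma p_pos [simp]: "p > 0" "p \<noteq> 0"
  using prime prime_gt_0_nat by auto

text \<open>Membership in \<open>p\<^sup>e \<int>\<^sub>(\<^sub>p\<^sub>)\<close>.\<close>

definition pdvd :: "nat \<Rightarrow> rat \<Rightarrow> bool" where
  "pdvd e x \<longleftrightarrow> (\<exists>a b. x = of_nat p ^ e * of_int a / of_int b \<and> \<not> int p dvd b)"

lemma pdvd_iff: "pdvd e x \<longleftrightarrow> padic_integer p (x / of_nat p ^ e)"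
  unfolding padic_integer_iff[OF prime] pdvd_def by (simp add: field_simps)

lemma rat_cong_iff: "rat_cong x y p \<longleftrightarrow> pdvd 1 (x - y)"
  by (simp add: rat_cong_def pdvd_iff)

lemma pdvd_0 [simp]: "pdvd e 0"
  unfolding pdvd_def by (rule exI[of _ 0], rule exI[of _ 1]) (use prime prime_gt_1_nat in auto)

lemma pdvd_of_int: "int p ^ e dvd k \<Longrightarrow> pdvd e (of_int k)"
  unfolding pdvd_def by (elim dvdE, rule exI, rule exI[of _ 1]) (use prime prime_gt_1_nat in auto)

lemma pdvd_of_nat: "p ^ e dvd k \<Longrightarrow> pdvd e (of_nat k)"
  using pdvd_of_int[of e "int k"] by (simp flip: of_nat_power)

lemma pdvd_0_of_int [simp]: "pdvd 0 (of_int k)" "pdvd 0 (of_nat j)" "pdvd 0 1"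
  using pdvd_of_int[of 0 k] pdvd_of_nat[of 0 j] pdvd_of_nat[of 0 1] by auto

lemma pdvd_mult: "pdvd e x \<Longrightarrow> pdvd f y \<Longrightarrow> pdvd (e + f) (x * y)"
  unfolding pdvd_def
proof (elim exE conjE)
  fix a b c d
  assume *: "x = of_nat p ^ e * of_int a / of_int b" "\<not> int p dvd b"
    "y = of_nat p ^ f * of_int c / of_int d" "\<not> int p dvd d"
  then have "\<not> int p dvd b * d"
    using prime by (simp add: prime_dvd_mult_iff)
  with * show "\<exists>a b. x * y = of_nat p ^ (e + f) * of_int a / of_int b \<and> \<not> int p dvd b"
    by (intro exI[of _ "a * c"] exI[of _ "b * d"]) (simp add: power_add)
qed

lemma pdvd_mult_left: "pdvd 0 x \<Longrightarrow> pdvd e y \<Longrightarrow> pdvd e (x * y)"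
  using pdvd_mult[of 0 x e y] by simp

lemma pdvd_add: "pdvd e x \<Longrightarrow> pdvd e y \<Longrightarrow> pdvd e (x + y)"
  unfolding pdvd_def
proof (elim exE conjE)
  fix a b c d
  assume *: "x = of_nat p ^ e * of_int a / of_int b" "\<not> int p dvd b"
    "y = of_nat p ^ e * of_int c / of_int d" "\<not> int p dvd d"
  then have "\<not> int p dvd b * d"
    using prime by (simp add: prime_dvd_mult_iff)
  moreover have "b \<noteq> 0" "d \<noteq> 0" using * by auto
  ultimately show "\<exists>a b. x + y = of_nat p ^ e * of_int a / of_int b \<and> \<not> int p dvd b"
    using * by (intro exI[of _ "a * d + c * b"] exI[of _ "b * d"]) (simp add: field_simps)
qed

lemma pdvd_uminus_iff [simp]: "pdvd e (- x) \<longleftrightarrow> pdvd e x"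
proof -
  have "pdvd e (- x)" if "pdvd e x" for x
    using pdvd_mult_left[OF pdvd_0_of_int(1)[of "- 1"] that] by simp
  from this[of x] this[of "- x"] show ?thesis by auto
qed

lemma pdvd_diff: "pdvd e x \<Longrightarrow> pdvd e y \<Longrightarrow> pdvd e (x - y)"
  using pdvd_add[of e x "- y"] by simp

lemma pdvd_diff_commute: "pdvd e (x - y) \<Longrightarrow> pdvd e (y - x)"
  using pdvd_uminus_iff[of e "x - y"] by simp

lemma pdvd_trans: "pdvd e (x - y) \<Longrightarrow> pdvd e (y - z) \<Longrightarrow> pdvd e (x - z)"
  using pdvd_add[of e "x - y" "y - z"] by simp

lemma pdvd_sum: "(\<And>i. i \<in> I \<Longrightarrow> pdvd e (f i)) \<Longrightarrow> pdvd e (sum f I)"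
  by (induction I rule: infinite_finite_induct) (auto intro: pdvd_add)

lemma pdvd_le: "pdvd f x \<Longrightarrow> e \<le> f \<Longrightarrow> pdvd e x"
proof -
  assume "pdvd f x" "e \<le> f"
  then obtain a b where x: "x = of_nat p ^ f * of_int a / of_int b" "\<not> int p dvd b"
    unfolding pdvd_def by blast
  have "(of_nat p ^ f :: rat) = of_nat p ^ e * of_int (int p ^ (f - e))"
    using \<open>e \<le> f\<close> by (simp flip: power_add)
  with x show ?thesis
    unfolding pdvd_def by (intro exI[of _ "int p ^ (f - e) * a"] exI[of _ b]) simp
qed

lemma pdvd_p_power: "pdvd e (of_nat p ^ e)"
  using pdvd_of_nat[of e "p ^ e"] by simp

lemma pdvd_cancel_p_power: "pdvd (e + f) (of_nat p ^ e * x) \<longleftrightarrow> pdvd f x"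
  by (simp add: pdvd_iff power_add)

lemma pdvd_power: "pdvd 0 x \<Longrightarrow> pdvd 0 (x ^ k)"
  by (induction k) (auto intro: pdvd_mult_left)

lemma pdvd_mult_cong:
  assumes "pdvd e (x - x')" "pdvd e (y - y')" "pdvd 0 x" "pdvd 0 y'"
  shows "pdvd e (x * y - x' * y')"
proof -
  have "x * y - x' * y' = x * (y - y') + y' * (x - x')" by (simp add: algebra_simps)
  with assms show ?thesis by (auto intro!: pdvd_add intro: pdvd_mult_left)
qed

lemma pdvd_power_cong:
  assumes "pdvd e (x - y)" "pdvd 0 x" "pdvd 0 y"
  shows "pdvd e (x ^ k - y ^ k)"
  by (induction k) (use assms in \<open>auto intro: pdvd_mult_cong pdvd_power\<close>)

lemma pdvd_inverse: "\<not> p dvd k \<Longrightarrow> pdvd 0 (1 / of_nat k)"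
  unfolding pdvd_def by (intro exI[of _ 1] exI[of _ "int k"]) auto

lemma pdvd_divide_p: "pdvd (e + 1) (of_nat k) \<Longrightarrow> pdvd e (of_nat k / of_nat p)"
  by (simp add: pdvd_iff)

text \<open>For odd \<open>p\<close> the difference is zero; for \<open>p = 2\<close> it is even
  whatever the sign. This treats both parities of \<open>p\<close> uniformly.\<close>

lemma neg_one_power_cong: "pdvd 1 ((- 1) ^ (p ^ j) - (- 1))"
proof (cases "p = 2")
  case True
  then show ?thesis
    using pdvd_of_int[of 1 "(- 1) ^ (p ^ j) + 1"] by simp
next
  case False
  then have "odd (p ^ j)" using prime prime_odd_nat by (metis even_power prime_gt_1_nat primes_dvd_imp_eq two_is_prime_nat)
  then show ?thesis by simp
qed

section \<open>Coefficientwise divisibility of truncated power series\<close>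

text \<open>The cutoff \<open>N\<close> is there because the exponential and Bernoulli series are
  p-integral only in low degrees.\<close>

definition fps_pdvd :: "nat \<Rightarrow> nat \<Rightarrow> rat fps \<Rightarrow> bool" where
  "fps_pdvd N e F \<longleftrightarrow> (\<forall>k\<le>N. pdvd e (F $ k))"

lemma fps_pdvdD: "fps_pdvd N e F \<Longrightarrow> k \<le> N \<Longrightarrow> pdvd e (F $ k)"
  by (simp add: fps_pdvd_def)

lemma fps_pdvd_add: "fps_pdvd N e F \<Longrightarrow> fps_pdvd N e G \<Longrightarrow> fps_pdvd N e (F + G)"
  by (auto simp: fps_pdvd_def intro: pdvd_add)

lemma fps_pdvd_diff: "fps_pdvd N e F \<Longrightarrow> fps_pdvd N e G \<Longrightarrow> fps_pdvd N e (F - G)"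
  by (auto simp: fps_pdvd_def intro: pdvd_diff)

lemma fps_pdvd_mult: "fps_pdvd N e F \<Longrightarrow> fps_pdvd N f G \<Longrightarrow> fps_pdvd N (e + f) (F * G)"
  unfolding fps_pdvd_def fps_mult_nth by (intro allI impI pdvd_sum pdvd_mult) auto

lemma fps_pdvd_mult_left: "fps_pdvd N 0 F \<Longrightarrow> fps_pdvd N e G \<Longrightarrow> fps_pdvd N e (F * G)"
  using fps_pdvd_mult[of N 0 F e G] by simp

lemma fps_pdvd_const: "pdvd e x \<Longrightarrow> fps_pdvd N e (fps_const x)"
  by (auto simp: fps_pdvd_def)

lemma fps_pdvd_1 [simp]: "fps_pdvd N 0 1"
  by (auto simp: fps_pdvd_def)

lemma fps_pdvd_X_power [simp]: "fps_pdvd N 0 (fps_X ^ k)"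
  by (auto simp: fps_pdvd_def)

lemma fps_pdvd_power: "fps_pdvd N 0 F \<Longrightarrow> fps_pdvd N 0 (F ^ k)"
  by (induction k) (auto intro: fps_pdvd_mult_left)

lemma fps_pdvd_mult_cong:
  assumes "fps_pdvd N e (F - F')" "fps_pdvd N e (G - G')" "fps_pdvd N 0 F" "fps_pdvd N 0 G'"
  shows "fps_pdvd N e (F * G - F' * G')"
proof -
  have "F * G - F' * G' = F * (G - G') + G' * (F - F')" by (simp add: algebra_simps)
  with assms show ?thesis by (auto intro!: fps_pdvd_add intro: fps_pdvd_mult_left)
qed

lemma fps_pdvd_power_cong:
  assumes "fps_pdvd N e (F - G)" "fps_pdvd N 0 F" "fps_pdvd N 0 G"
  shows "fps_pdvd N e (F ^ k - G ^ k)"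
proof (induction k)
  case 0
  then show ?case by (simp add: fps_pdvd_def)
next
  case (Suc k)
  then show ?case using assms by (auto intro: fps_pdvd_mult_cong fps_pdvd_power)
qed

lemma fps_pdvd_one_minus_X_power: "fps_pdvd N 0 ((1 - fps_X) ^ k)"
  unfolding fps_pdvd_def one_minus_fps_X_power_nth
  by (auto intro!: pdvd_mult_left pdvd_power)

section \<open>Binomial coefficients and powers of series modulo a prime\<close>

text \<open>The multiplicity of \<open>p\<close> in \<open>k\<close> is at most
  \<open>s - 1\<close>, so at least \<open>a - (s - 1)\<close> factors must come from
  \<open>c\<close>.\<close>

lemma prime_power_dvd_cancel:
  assumes "p ^ a dvd k * c" "\<not> p ^ s dvd k"
  shows "p ^ (a + 1 - s) dvd c"
proof -
  obtain j where "j < s" and k: "\<exists>u. k = p ^ j * u \<and> \<not> p dvd u"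
  proof -
    have "k \<noteq> 0" using assms(2) by (metis dvd_0_right)
    then obtain u where u: "k = p ^ multiplicity p k * u" "\<not> p dvd u"
      using multiplicity_decompose'[of k p] prime not_prime_unit by metis
    moreover have "multiplicity p k < s"
      using assms(2) u(1) by (metis dvd_triv_left le_imp_power_dvd dvd_trans not_less)
    ultimately show ?thesis using that by blast
  qed
  then obtain u where u: "k = p ^ j * u" "\<not> p dvd u" by blast
  show ?thesis
  proof (cases "j \<le> a")
    case False
    then show ?thesis using \<open>j < s\<close> by simp
  next
    case True
    then have "p ^ a = p ^ j * p ^ (a - j)"
      by (simp flip: power_add)
    then have "p ^ j * p ^ (a - j) dvd p ^ j * (u * c)"
      using assms(1) u(1) by (simp only: mult.assoc)
    then have "p ^ (a - j) dvd u * c" by simp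
    moreover have "coprime (p ^ (a - j)) u"
      using u prime by (simp add: prime_imp_coprime)
    ultimately have "p ^ (a - j) dvd c"
      by (simp add: coprime_dvd_mult_right_iff)
    moreover have "a + 1 - s \<le> a - j" using \<open>j < s\<close> by simp
    ultimately show ?thesis by (meson le_imp_power_dvd dvd_trans)
  qed
qed

lemma prime_power_dvd_times_binomial: "p ^ a dvd k * (p ^ a choose k)"
proof (cases k)
  case (Suc k')
  then show ?thesis
    using binomial_absorption[of k' "p ^ a"] by (simp only: dvd_triv_left)
qed simp

lemma prime_dvd_binomial_prime_power: "0 < k \<Longrightarrow> k < p ^ a \<Longrightarrow> p dvd (p ^ a choose k)"
  using prime_power_dvd_cancel[OF prime_power_dvd_times_binomial[of a k], of a]
  by (metis One_nat_def add_diff_cancel_left' dvd_imp_le leD power_one_right)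

text \<open>By Pascal's rule two neighbouring entries of row \<open>p ^ a - 1\<close> add up to an
  inner entry of row \<open>p ^ a\<close>, which is 0 modulo \<open>p\<close>; so the entries
  alternate in sign starting from 1.\<close>

lemma binomial_prime_power_minus_one_cong:
  assumes "k < p ^ a"
  shows "pdvd 1 (of_nat (p ^ a - 1 choose k) - (- 1) ^ k)"
  using assms
proof (induction k)
  case (Suc k)
  obtain n where "p ^ a = Suc n"
    using Suc.prems by (cases "p ^ a") auto
  then have "p ^ a choose Suc k = (p ^ a - 1 choose k) + (p ^ a - 1 choose Suc k)"
    by simp
  then have "of_nat (p ^ a - 1 choose Suc k) - (- 1) ^ Suc k
      = of_nat (p ^ a choose Suc k) - (of_nat (p ^ a - 1 choose k) - (- 1) ^ k :: rat)"
    by simp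
  moreover have "pdvd 1 (of_nat (p ^ a choose Suc k))"
    using Suc.prems by (intro pdvd_of_nat) (simp add: prime_dvd_binomial_prime_power)
  moreover have "pdvd 1 (of_nat (p ^ a - 1 choose k) - (- 1) ^ k)"
    using Suc by simp
  ultimately show ?case by (simp only: pdvd_diff)
qed simp

lemma fps_pdvd_frobenius:
  "fps_pdvd N 1 ((1 - fps_X) ^ (p ^ j) - (1 - fps_X ^ (p ^ j)))"
  unfolding fps_pdvd_def
proof (intro allI impI)
  fix k
  have "0 < p ^ j" by simp
  consider "k = 0" | "k = p ^ j" | "k > p ^ j" | "0 < k" "k < p ^ j" by linarith
  then show "pdvd 1 (((1 - fps_X) ^ (p ^ j) - (1 - fps_X ^ (p ^ j))) $ k)"
  proof cases
    case 2
    then show ?thesis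
      using neg_one_power_cong[of j] by (simp add: one_minus_fps_X_power_nth)
  next
    case 4
    then have "pdvd 1 (of_nat (p ^ j choose k))"
      by (intro pdvd_of_nat) (simp add: prime_dvd_binomial_prime_power)
    then have "pdvd 1 ((- 1) ^ k * of_nat (p ^ j choose k))"
      by (intro pdvd_mult_left pdvd_power) auto
    with 4 show ?thesis
      by (auto simp: one_minus_fps_X_power_nth)
  next
    case 3
    then show ?thesis by (simp add: one_minus_fps_X_power_nth binomial_eq_0)
  qed (auto simp: one_minus_fps_X_power_nth)
qed

text \<open>As \<open>G $ 0 = 1\<close>, the recursion for the coefficients of the inverse involves
  no division.\<close>

lemma fps_pdvd_inverse:
  assumes "F * G = 1" "G $ 0 = 1" "fps_pdvd N 0 G"
  shows "fps_pdvd N 0 F"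
  unfolding fps_pdvd_def
proof (intro allI impI)
  fix k assume "k \<le> N"
  then show "pdvd 0 (F $ k)"
  proof (induction k rule: less_induct)
    case (less k)
    have "{0..k} = insert k {..<k}" by auto
    then have "(F * G) $ k = (\<Sum>i<k. F $ i * G $ (k - i)) + F $ k"
      by (simp add: fps_mult_nth assms(2))
    then have "F $ k = (1 :: rat fps) $ k - (\<Sum>i<k. F $ i * G $ (k - i))"
      by (simp add: assms(1))
    also have "pdvd 0 \<dots>"
      using less assms(3) by (intro pdvd_diff pdvd_sum pdvd_mult_left) (auto simp: fps_pdvd_def)
    finally show ?case .
  qed
qed

text \<open>Expand (1 + X)^p: the inner binomial coefficients are divisible by \<open>p\<close>, and
  \<open>X ^ p\<close> has order at least \<open>p\<close>, beyond the cutoff.\<close>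

lemma fps_power_prime_cong_one:
  assumes "fps_pdvd N 0 F" "F $ 0 = 1" "N < p"
  shows "fps_pdvd N 1 (F ^ p - 1)"
proof -
  define X where "X = F - 1"
  have X0: "X $ 0 = 0" and X: "fps_pdvd N 0 X"
    using assms by (auto simp: X_def intro: fps_pdvd_diff)
  have "F ^ p = (X + 1) ^ p" by (simp add: X_def)
  also have "\<dots> = (\<Sum>k\<le>p. of_nat (p choose k) * X ^ k)"
    by (subst binomial_ring) simp
  finally have F: "F ^ p = (\<Sum>k\<le>p. of_nat (p choose k) * X ^ k)" .
  have p: "{..p} = insert 0 {1..p}" by auto
  have F': "F ^ p - 1 = (\<Sum>k=1..p. of_nat (p choose k) * X ^ k)"
    unfolding F p by (subst sum.insert) auto
  have "pdvd 1 ((of_nat (p choose k) * X ^ k) $ i)" if k: "k \<in> {1..p}" and i: "i \<le> N" for k i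
  proof (cases "k = p")
    case True
    then show ?thesis using startsby_zero_power_prefix[OF X0] i assms(3) by simp
  next
    case False
    then have "pdvd 1 (of_nat (p choose k))"
      using k prime_dvd_binomial_prime_power[of k 1] by (intro pdvd_of_nat) auto
    then have "pdvd (1 + 0) (of_nat (p choose k) * (X ^ k) $ i)"
      by (rule pdvd_mult) (rule fps_pdvdD[OF fps_pdvd_power[OF X] i])
    then show ?thesis
      unfolding fps_of_nat[symmetric] fps_mult_left_const_nth by simp
  qed
  then show ?thesis
    unfolding F' fps_pdvd_def fps_sum_nth by (auto intro: pdvd_sum)
qed


subsection \<open>Binomial coefficients of prime powers\<close>

text \<open>The polynomial \<open>A\<close> of the introduction; see \<open>binomial_fps_eq\<close>.\<close>

definition binomial_fps :: "nat \<Rightarrow> rat fps" where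
  "binomial_fps a = Abs_fps (\<lambda>k. if 0 < k \<and> k < p ^ a
     then (- 1) ^ k * of_nat (p ^ a choose k) / of_nat p else 0)"

lemma neg_one_power_prime_power:
  assumes "a > 0"
  shows "(- 1) ^ (p ^ a) = ((- 1) ^ p :: rat)"
  using assms by (cases "even p") (simp_all add: uminus_power_if)

text \<open>In degree \<open>p ^ a\<close> both terms on the right cancel, since
  \<open>p ^ a\<close> and \<open>p\<close> have the same parity; this dictates the sign
  (-1)^p.\<close>

lemma binomial_fps_eq:
  assumes "a > 0"
  shows "1 + fps_const (of_nat p) * binomial_fps a
       = (1 - fps_X) ^ (p ^ a) - fps_const ((- 1) ^ p) * fps_X ^ (p ^ a)"
proof (rule fps_ext)
  fix k
  consider "k = 0" | "k = p ^ a" | "k > p ^ a" | "0 < k" "k < p ^ a" by linarith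
  then show "(1 + fps_const (of_nat p) * binomial_fps a) $ k
      = ((1 - fps_X) ^ (p ^ a) - fps_const ((- 1) ^ p) * fps_X ^ (p ^ a)) $ k"
    by cases (simp_all add: binomial_fps_def one_minus_fps_X_power_nth binomial_eq_0
        neg_one_power_prime_power[OF assms])
qed

lemma binomial_fps_0: "binomial_fps a $ 0 = 0"
  by (simp add: binomial_fps_def)

lemma pdvd_binomial_fps_nth:
  assumes "p ^ (e + 1) dvd (p ^ a choose k)"
  shows "pdvd e (binomial_fps a $ k)"
proof -
  have "pdvd e (of_nat (p ^ a choose k) / of_nat p)"
    using assms by (intro pdvd_divide_p pdvd_of_nat)
  then have "pdvd e ((- 1) ^ k * (of_nat (p ^ a choose k) / of_nat p))"
    by (intro pdvd_mult_left pdvd_power) auto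
  then show ?thesis by (simp add: binomial_fps_def)
qed

text \<open>The binomial coefficient carries a + 1 - s factors \<open>p\<close>, one of which is
  used up by the division in \<open>binomial_fps\<close>.\<close>

lemma pdvd_binomial_fps_nth':
  assumes "\<not> p ^ s dvd k" "s \<le> a"
  shows "pdvd (a - s) (binomial_fps a $ k)"
  using prime_power_dvd_cancel[OF prime_power_dvd_times_binomial assms(1), of a] assms(2)
  by (intro pdvd_binomial_fps_nth) (simp add: Suc_diff_le)

lemma fps_pdvd_binomial_fps: "fps_pdvd N 0 (binomial_fps a)"
  unfolding fps_pdvd_def
proof (intro allI impI)
  fix k show "pdvd 0 (binomial_fps a $ k)"
  proof (cases "0 < k \<and> k < p ^ a")
    case True
    then show ?thesis
      by (intro pdvd_binomial_fps_nth) (simp add: prime_dvd_binomial_prime_power)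
  next
    case False
    then show ?thesis by (auto simp: binomial_fps_def)
  qed
qed

lemma reciprocal_binomial_fps:
  assumes "a > 0"
  shows "reciprocal ((- 1) ^ p) (p ^ a) (binomial_fps a)"
  unfolding reciprocal_def
proof (intro conjI allI impI)
  fix k assume k: "k \<le> p ^ a"
  show "binomial_fps a $ (p ^ a - k) = (- 1) ^ p * binomial_fps a $ k"
  proof (cases "0 < k \<and> k < p ^ a")
    case True
    have "(- 1) ^ p = (- 1) ^ (p ^ a - k) * (- 1 :: rat) ^ k"
      using k by (simp add: neg_one_power_prime_power[OF assms] flip: power_add)
    moreover have "(- 1) ^ k * (- 1) ^ k = (1 :: rat)"
      by (simp flip: power_mult_distrib)
    ultimately have "(- 1) ^ p * (- 1) ^ k = ((- 1) ^ (p ^ a - k) :: rat)"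
      by simp
    moreover have "p ^ a choose (p ^ a - k) = p ^ a choose k"
      using k by (simp flip: binomial_symmetric)
    ultimately show ?thesis using True by (simp add: binomial_fps_def)
  next
    case False
    then show ?thesis using k by (auto simp: binomial_fps_def)
  qed
qed (simp add: binomial_fps_def)

text \<open>A term \<open>c x\<^sup>k\<close> of low degree \<open>k\<close> in \<^term>\<open>binomial_fps a\<close> is divisible by \<open>p\<close> if
  \<open>k < p\<^bsup>a-1\<^esup>\<close> and by \<open>p\<^sup>2\<close> if \<open>k < p\<^bsup>a-2\<^esup>\<close>.\<close>

lemma binomial_fps_decomposition:
  assumes "a > 0"
  obtains U V W where "binomial_fps a = U + fps_const (of_nat p) * V + fps_const (of_nat p ^ 2) * W"
    and "vanishes_below (p ^ (a - 1)) U" "vanishes_below (p ^ (a - 2)) V"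
    and "\<And>N. fps_pdvd N 0 U" "\<And>N. fps_pdvd N 0 V" "\<And>N. fps_pdvd N 0 W"
proof
  define A where "A = binomial_fps a"
  \<comment> \<open>The coefficients are sorted by whether their index is a multiple of
    \<open>p ^ (a - 1)\<close>, only of \<open>p ^ (a - 2)\<close>, or of neither. A positive
    multiple is at least the power itself, which bounds the orders.\<close>
  define U where "U = Abs_fps (\<lambda>k. if p ^ (a - 1) dvd k then A $ k else 0)"
  define V where "V = Abs_fps (\<lambda>k. if \<not> p ^ (a - 1) dvd k \<and> p ^ (a - 2) dvd k then A $ k / of_nat p else 0)"
  define W where "W = Abs_fps (\<lambda>k. if \<not> p ^ (a - 1) dvd k \<and> \<not> p ^ (a - 2) dvd k then A $ k / of_nat p ^ 2 else 0)"
  show "binomial_fps a = U + fps_const (of_nat p) * V + fps_const (of_nat p ^ 2) * W"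
    by (rule fps_ext) (simp add: U_def V_def W_def A_def)
  show "vanishes_below (p ^ (a - 1)) U" "vanishes_below (p ^ (a - 2)) V"
    by (auto simp: vanishes_below_def U_def V_def A_def binomial_fps_0 dest: dvd_imp_le)
  show "fps_pdvd N 0 U" for N
    using fps_pdvd_binomial_fps[of N a] by (auto simp: fps_pdvd_def U_def A_def)
  have "pdvd 0 (A $ k / of_nat p)" if "\<not> p ^ (a - 1) dvd k" for k
    using pdvd_binomial_fps_nth'[OF that, of a] assms by (simp add: A_def pdvd_iff)
  then show "fps_pdvd N 0 V" for N
    by (auto simp: fps_pdvd_def V_def)
  have "pdvd 0 (A $ k / of_nat p ^ 2)" if "\<not> p ^ (a - 1) dvd k" "\<not> p ^ (a - 2) dvd k" for k
  proof -
    \<comment> \<open>For a = 1 every index is a multiple of \<open>p ^ (a - 1) = 1\<close>, so this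
      class is empty and the truncated \<open>a - 2\<close> does no harm.\<close>
    have "a \<noteq> 1" using that by (cases "a = 1") auto
    then have "a \<ge> 2" using assms by simp
    then show ?thesis
      using pdvd_binomial_fps_nth'[OF that(2), of a] by (simp add: A_def pdvd_iff)
  qed
  then show "fps_pdvd N 0 W" for N
    by (auto simp: fps_pdvd_def W_def)
qed

text \<open>Modulo p^2 a product of factors U + pV + p^2 W keeps only the terms with no V or with
  exactly one V. Orders add, so replacing one U by V exchanges one summand
  \<open>p ^ (a - 1)\<close> for \<open>p ^ (a - 2)\<close>.\<close>

lemma binomial_fps_power_decomposition:
  assumes "a > 0"
  shows "\<exists>U V W. binomial_fps a ^ Suc r = U + fps_const (of_nat p) * V + fps_const (of_nat p ^ 2) * W
    \<and> vanishes_below (p ^ (a - 1) * Suc r) U \<and> vanishes_below (p ^ (a - 1) * r + p ^ (a - 2)) V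
    \<and> fps_pdvd N 0 U \<and> fps_pdvd N 0 V \<and> fps_pdvd N 0 W"
proof (induction r)
  case 0
  obtain U V W where "binomial_fps a = U + fps_const (of_nat p) * V + fps_const (of_nat p ^ 2) * W"
    and "vanishes_below (p ^ (a - 1)) U" "vanishes_below (p ^ (a - 2)) V"
    and "\<And>N. fps_pdvd N 0 U" "\<And>N. fps_pdvd N 0 V" "\<And>N. fps_pdvd N 0 W"
    using binomial_fps_decomposition[OF assms] by metis
  then show ?case by (intro exI[of _ U] exI[of _ V] exI[of _ W]) simp
next
  case (Suc r)
  define c :: "rat fps" where "c = fps_const (of_nat p)"
  have c2: "fps_const (of_nat p ^ 2) = c ^ 2" by (simp add: c_def fps_const_power)
  have c: "fps_pdvd N 0 c" by (simp add: c_def fps_pdvd_const)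
  obtain U V W where A: "binomial_fps a = U + c * V + c ^ 2 * W"
    and A': "vanishes_below (p ^ (a - 1)) U" "vanishes_below (p ^ (a - 2)) V"
    "\<And>N. fps_pdvd N 0 U" "\<And>N. fps_pdvd N 0 V" "\<And>N. fps_pdvd N 0 W"
    using binomial_fps_decomposition[OF assms] unfolding c_def[symmetric] c2 by metis
  obtain U' V' W' where B: "binomial_fps a ^ Suc r = U' + c * V' + c ^ 2 * W'"
    and B': "vanishes_below (p ^ (a - 1) * Suc r) U'"
    "vanishes_below (p ^ (a - 1) * r + p ^ (a - 2)) V'"
    "fps_pdvd N 0 U'" "fps_pdvd N 0 V'" "fps_pdvd N 0 W'"
    using Suc unfolding c_def[symmetric] c2 by metis
  have "binomial_fps a ^ Suc (Suc r) = (U' + c * V' + c ^ 2 * W') * (U + c * V + c ^ 2 * W)"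
    unfolding power_Suc[of _ "Suc r"] B A[symmetric] by (simp add: mult.commute)
  also have "\<dots> = U' * U + c * (U' * V + V' * U)
      + c ^ 2 * (U' * W + V' * (V + c * W) + W' * (U + c * V + c ^ 2 * W))"
    by (simp add: algebra_simps power2_eq_square)
  finally have "binomial_fps a ^ Suc (Suc r) = U' * U + c * (U' * V + V' * U)
      + c ^ 2 * (U' * W + V' * (V + c * W) + W' * (U + c * V + c ^ 2 * W))" .
  moreover have "vanishes_below (p ^ (a - 1) * Suc (Suc r)) (U' * U)"
    using vanishes_below_mult[OF B'(1) A'(1)] by (simp add: algebra_simps)
  moreover have "vanishes_below (p ^ (a - 1) * Suc r + p ^ (a - 2)) (U' * V + V' * U)"
    using vanishes_below_mult[OF B'(1) A'(2)] vanishes_below_mult[OF B'(2) A'(1)]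
    by (intro vanishes_below_add) (simp_all add: algebra_simps)
  moreover have "fps_pdvd N 0 (U' * U)" "fps_pdvd N 0 (U' * V + V' * U)"
    "fps_pdvd N 0 (U' * W + V' * (V + c * W) + W' * (U + c * V + c ^ 2 * W))"
    using A' B' c by (intro fps_pdvd_add fps_pdvd_mult_left fps_pdvd_power; simp)+
  ultimately show ?case
    unfolding c_def[symmetric] c2 by (intro exI conjI)
qed

text \<open>In degrees up to \<open>p ^ (a - 1) * m + d - 1\<close> both U and V of the power with
  exponent \<open>m + 1\<close> vanish, by the bound on \<open>d\<close>; only p^2 W is left, and
  further factors are integral.\<close>

lemma fps_pdvd_binomial_fps_power:
  assumes "a > 0" "d \<ge> 1" "d \<le> p ^ (a - 2)" "r > m"
  shows "fps_pdvd (p ^ (a - 1) * m + d - 1) 2 (binomial_fps a ^ r)"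
proof -
  define N where "N = p ^ (a - 1) * m + d - 1"
  obtain U V W where A: "binomial_fps a ^ Suc m = U + fps_const (of_nat p) * V + fps_const (of_nat p ^ 2) * W"
    and U: "vanishes_below (p ^ (a - 1) * Suc m) U"
    and V: "vanishes_below (p ^ (a - 1) * m + p ^ (a - 2)) V"
    and W: "fps_pdvd N 0 W"
    using binomial_fps_power_decomposition[OF assms(1), of m N] by metis
  have le: "p ^ (a - 2) \<le> p ^ (a - 1)"
    by (intro power_increasing) (auto simp: Suc_le_eq)
  have "fps_pdvd N 2 (binomial_fps a ^ Suc m)"
    unfolding fps_pdvd_def
  proof (intro allI impI)
    fix k assume k: "k \<le> N"
    have N: "N < p ^ (a - 1) * m + p ^ (a - 2)" using assms by (simp add: N_def)
    moreover have "N < p ^ (a - 1) * Suc m" using N le by simp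
    ultimately have "U $ k = 0" "V $ k = 0"
      using k U V by (auto simp: vanishes_below_def)
    then have "(binomial_fps a ^ Suc m) $ k = of_nat p ^ 2 * W $ k"
      unfolding A by simp
    also have "pdvd (2 + 0) \<dots>"
      by (rule pdvd_mult[OF pdvd_p_power]) (rule fps_pdvdD[OF W k])
    finally show "pdvd 2 ((binomial_fps a ^ Suc m) $ k)" by simp
  qed
  then have "fps_pdvd N 2 (binomial_fps a ^ (r - Suc m) * binomial_fps a ^ Suc m)"
    by (intro fps_pdvd_mult_left fps_pdvd_power fps_pdvd_binomial_fps)
  then show ?thesis
    using assms(4) by (simp add: N_def flip: power_add power_Suc del: power_Suc)
qed

section \<open>The truncated logarithm modulo p\<close>

text \<open>The series of -log(1 - x), cut off before the first denominator divisible by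
  \<open>p\<close>.\<close>

definition log_fps :: "rat fps" where
  "log_fps = Abs_fps (\<lambda>j. if 0 < j \<and> j < p then 1 / of_nat j else 0)"

lemma fps_pdvd_log_fps: "fps_pdvd N 0 log_fps"
  by (auto simp: fps_pdvd_def log_fps_def intro!: pdvd_inverse dest: dvd_imp_le)

lemma fps_pdvd_compose_X_power:
  assumes "b > 0" "\<And>N. fps_pdvd N e F"
  shows "fps_pdvd N e (F oo fps_X ^ b)"
  using assms(2) by (auto simp: fps_pdvd_def fps_nth_compose_X_power)

text \<open>Indices that are not multiples of b = p^(a-1) have coefficients divisible by
  \<open>p\<close>. For k = bj, absorption gives binom(p^a, k)/p = binom(p^a - 1, k - 1)/j, whose
  numerator is (-1)^(k-1) modulo \<open>p\<close>.\<close>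

lemma binomial_fps_cong_log_fps:
  assumes "a > 0"
  shows "fps_pdvd N 1 (binomial_fps a - - (log_fps oo fps_X ^ (p ^ (a - 1))))"
  unfolding fps_pdvd_def
proof (intro allI impI)
  fix k
  define b where "b = p ^ (a - 1)"
  have b: "p ^ a = p * b" "b > 0" using assms by (cases a; simp add: b_def)+
  show "pdvd 1 ((binomial_fps a - - (log_fps oo fps_X ^ (p ^ (a - 1)))) $ k)"
    unfolding b_def[symmetric]
  proof (cases "b dvd k")
    case False
    then have "pdvd 1 (binomial_fps a $ k)"
      using pdvd_binomial_fps_nth'[of "a - 1" k a] assms by (simp add: b_def)
    then show "pdvd 1 ((binomial_fps a - - (log_fps oo fps_X ^ b)) $ k)"
      using False by (simp add: fps_nth_compose_X_power)
  next
    case True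
    then obtain j where j: "k = b * j" by blast
    show "pdvd 1 ((binomial_fps a - - (log_fps oo fps_X ^ b)) $ k)"
    proof (cases "0 < j \<and> j < p")
      case False
      then show ?thesis
        using b by (auto simp: fps_nth_compose_X_power j binomial_fps_def log_fps_def)
    next
      case jp: True
      then have k: "0 < k" "k < p ^ a" using b by (simp_all add: j)
      then have "k * (p ^ a choose k) = p ^ a * (p ^ a - 1 choose (k - 1))"
        using binomial_absorption[of "k - 1" "p ^ a"] by simp
      then have "j * (p ^ a choose k) = p * (p ^ a - 1 choose (k - 1))"
        using b by (simp add: j mult_ac)
      then have "of_nat j * of_nat (p ^ a choose k) = (of_nat p * of_nat (p ^ a - 1 choose (k - 1)) :: rat)"
        by (simp only: flip: of_nat_mult)
      then have "of_nat (p ^ a choose k) / of_nat p = (of_nat (p ^ a - 1 choose (k - 1)) / of_nat j :: rat)"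
        using jp by (simp add: field_simps)
      then have A: "binomial_fps a $ k = (- 1) ^ k * of_nat (p ^ a - 1 choose (k - 1)) / of_nat j"
        using k by (simp add: binomial_fps_def flip: times_divide_eq_right)
      have "(- 1) ^ k * (- 1) ^ (k - 1) = (- 1 :: rat)"
        using k by (cases k) (simp_all flip: power_mult_distrib)
      then have "binomial_fps a $ k + 1 / of_nat j
          = (- 1) ^ k * (1 / of_nat j) * (of_nat (p ^ a - 1 choose (k - 1)) - (- 1) ^ (k - 1))"
        unfolding A by (simp add: algebra_simps add_divide_distrib diff_divide_distrib)
      also have "pdvd 1 \<dots>"
        using k jp by (intro pdvd_mult_left binomial_prime_power_minus_one_cong pdvd_power pdvd_inverse)
          (auto dest: dvd_imp_le)
      finally show ?thesis
        using jp b by (simp add: fps_nth_compose_X_power j log_fps_def)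
    qed
  qed
qed

text \<open>Modulo \<open>p\<close> both (1 - x)^(bm) and the power of \<open>binomial_fps a\<close>
  become series in x^b. The remaining factor (1 - x)^(d-1) has degree below b, and the index is b(m
  + p) + (d - 1), so \<open>one_minus_X_power_mult_compose_nth\<close> applies.\<close>

lemma binomial_fps_power_nth_cong:
  assumes "a > 0" "d \<ge> 1" "d \<le> p ^ (a - 1)"
  shows "pdvd 1 (((1 - fps_X) ^ (p ^ (a - 1) * m + d - 1) * binomial_fps a ^ D) $ (p ^ (a - 1) * m + d - 1 + p ^ a)
     - (- 1) ^ (d - 1) * (- 1) ^ D * ((1 - fps_X) ^ m * log_fps ^ D) $ (m + p))"
proof -
  define b where "b = p ^ (a - 1)"
  have b: "p ^ a = p * b" "b > 0" using assms by (cases a; simp add: b_def)+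
  define e where "e = d - 1"
  have e: "e < b" "p ^ (a - 1) * m + d - 1 = b * m + e"
    using assms by (auto simp: e_def b_def)
  define N where "N = b * (m + p) + e"
  have N: "N = b * m + e + p ^ a" by (simp add: N_def b algebra_simps)
  define B where "B = log_fps oo fps_X ^ b"
  have Xb0: "(fps_X ^ b :: rat fps) $ 0 = 0" using b by simp
  have 1: "fps_pdvd N 1 ((1 - fps_X) ^ (b * m) - (1 - fps_X ^ b) ^ m)"
    unfolding power_mult b_def
    by (intro fps_pdvd_power_cong fps_pdvd_frobenius fps_pdvd_one_minus_X_power fps_pdvd_diff) simp_all
  have B: "fps_pdvd N 0 B"
    unfolding B_def by (intro fps_pdvd_compose_X_power b fps_pdvd_log_fps)
  then have B': "fps_pdvd N 0 (- B)" by (simp add: fps_pdvd_def)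
  have 2: "fps_pdvd N 1 (binomial_fps a ^ D - (- B) ^ D)"
    unfolding B_def b_def
    using B' by (intro fps_pdvd_power_cong binomial_fps_cong_log_fps assms fps_pdvd_binomial_fps)
       (simp add: B_def b_def)
  have "fps_pdvd N 1 ((1 - fps_X) ^ (b * m) * binomial_fps a ^ D - (1 - fps_X ^ b) ^ m * (- B) ^ D)"
    using B' by (intro fps_pdvd_mult_cong 1 2 fps_pdvd_one_minus_X_power fps_pdvd_power)
  then have "fps_pdvd N 1 ((1 - fps_X) ^ e *
      ((1 - fps_X) ^ (b * m) * binomial_fps a ^ D - (1 - fps_X ^ b) ^ m * (- B) ^ D))"
    by (intro fps_pdvd_mult_left fps_pdvd_one_minus_X_power)
  then have "pdvd 1 (((1 - fps_X) ^ e * ((1 - fps_X) ^ (b * m) * binomial_fps a ^ D)) $ N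
      - ((1 - fps_X) ^ e * ((1 - fps_X ^ b) ^ m * (- B) ^ D)) $ N)"
    by (auto simp: right_diff_distrib dest: fps_pdvdD)
  moreover have "(1 - fps_X ^ b) ^ m * (- B) ^ D
      = ((1 - fps_X) ^ m * (- log_fps) ^ D) oo fps_X ^ b"
    by (simp only: B_def fps_compose_mult_distrib[OF Xb0] fps_compose_sub_distrib fps_compose_uminus
        fps_compose_1 fps_X_fps_compose_startby0[OF Xb0] flip: fps_compose_power[OF Xb0])
  then have "((1 - fps_X) ^ e * ((1 - fps_X ^ b) ^ m * (- B) ^ D)) $ N
      = (- 1) ^ e * ((1 - fps_X) ^ m * (- log_fps) ^ D) $ (m + p)"
    unfolding N_def by (simp only: one_minus_X_power_mult_compose_nth[OF e(1)])
  moreover have "(1 - fps_X) ^ m * (- log_fps) ^ D = fps_const ((- 1) ^ D) * ((1 - fps_X) ^ m * log_fps ^ D)"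
    by (subst power_minus) (simp add: fps_const_power[symmetric] fps_const_neg[symmetric] mult_ac del: fps_const_neg fps_const_power)
  ultimately show ?thesis
    unfolding e N[symmetric] e_def[symmetric] power_add
    by (simp only: fps_mult_left_const_nth mult.assoc mult.left_commute[of "(1 - fps_X) ^ (b * m)" "(1 - fps_X) ^ e"])
qed


section \<open>Reduction of the sum to a single term\<close>

text \<open>In the expansion into terms \<open>K i\<close> only \<open>K D\<close> survives modulo
  p^(D+1). Each \<open>T i\<close> is a reciprocal polynomial of formal degree (c - 1) + qi, so its
  coefficient in degree M = q(D - 1) can be read off near the bottom.\<close>

lemma binomial_sum_cong:
  fixes a l m n d D :: nat
  defines "c \<equiv> p ^ (a - 1) * m + d"
  assumes "a > 0" "m < p" "d \<ge> 1" "d \<le> p ^ (a - 2)" "n = l + D" "D \<ge> m + 2"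
  shows "pdvd (D + 1)
    ((\<Sum>k\<in>{l<..n}. of_nat ((p ^ a * n - c) choose (p ^ a * k - c)) * ((- 1) ^ p) ^ k * of_nat ((k - 1) choose l))
      - of_nat p ^ D * (of_nat (n choose l) * ((- 1) ^ p) ^ (l + 1) * (- 1) ^ D *
         ((- 1) ^ (c - 1) * ((- 1) ^ p) ^ D * ((1 - fps_X) ^ (c - 1) * binomial_fps a ^ D) $ (c - 1 + p ^ a))))"
proof -
  define q where "q = p ^ a"
  define \<epsilon> :: rat where "\<epsilon> = (- 1) ^ p"
  define A where "A = binomial_fps a"
  define T where "T i = (1 - fps_X) ^ (c - 1) * A ^ i" for i
  define M where "M = q * (D - 1)"
  define K where "K i = of_nat ((l + i) choose l) * (- of_nat p) ^ i * T i $ M" for i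
  have "p ^ (a - 2) \<le> p ^ (a - 1)"
    by (intro power_increasing) (auto simp: Suc_le_eq)
  then have "c \<le> p ^ (a - 1) * (m + 1)" using assms by (simp add: c_def)
  also have "\<dots> \<le> p ^ (a - 1) * p" using \<open>m < p\<close> by (intro mult_le_mono2) simp
  also have "\<dots> = q" using \<open>a > 0\<close> by (cases a) (simp_all add: q_def)
  finally have cq: "c \<le> q" .
  have c1: "c \<ge> 1" and q1: "q \<ge> 1" using assms by (simp_all add: c_def q_def Suc_le_eq)
  obtain V where V: "V * (1 + fps_const (of_nat p) * A) ^ (l + 1) = 1"
    and V': "\<And>P M. (P * V) $ M = (\<Sum>i\<le>M. of_nat ((l + i) choose l) * (- of_nat p) ^ i * (P * A ^ i) $ M)"
    using inverse_power_expansion[of A "of_nat p" l] binomial_fps_0[of a] unfolding A_def by blast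
  have S: "(\<Sum>k\<in>{l<..n}. of_nat ((q * n - c) choose (q * k - c)) * \<epsilon> ^ k * of_nat ((k - 1) choose l))
      = \<epsilon> ^ (l + 1) * (\<Sum>i\<le>M. K i)"
    using binomial_sum_eq_fps_nth[OF c1 cq q1, of l n "1 + fps_const (of_nat p) * A" \<epsilon> V] V
      assms binomial_fps_eq[OF \<open>a > 0\<close>] V'[of "(1 - fps_X) ^ (c - 1)" M]
    by (simp add: A_def q_def \<epsilon>_def K_def T_def M_def)
  have rec: "reciprocal ((- 1) ^ (c - 1) * \<epsilon> ^ i) ((c - 1) + q * i) (T i)" for i
    unfolding T_def A_def \<epsilon>_def q_def
    using reciprocal_mult[OF reciprocal_power[OF reciprocal_one_minus_X]
        reciprocal_power[OF reciprocal_binomial_fps[OF \<open>a > 0\<close>]]] by simp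
  have intT: "fps_pdvd N 0 (T i)" for N i
    unfolding T_def A_def
    by (intro fps_pdvd_mult_left fps_pdvd_one_minus_X_power fps_pdvd_power fps_pdvd_binomial_fps)
  have small: "K i = 0" if "i + 2 \<le> D" for i
  proof -
    have "(c - 1) + q * i < q * (i + 1)" using cq c1 by simp
    also have "\<dots> \<le> M" unfolding M_def using that by (intro mult_le_mono2) simp
    finally have "T i $ M = 0" using rec[of i] by (simp add: reciprocal_def)
    then show ?thesis by (simp add: K_def)
  qed
  have nth: "T i $ ((c - 1) + q * i - k) = (- 1) ^ (c - 1) * \<epsilon> ^ i * T i $ k"
    if "k \<le> (c - 1) + q * i" for i k
    using rec[of i] that by (simp add: reciprocal_def)
  have pK: "pdvd (e + i) (K i)" if "pdvd e (T i $ M)" for i e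
  proof -
    have "K i = (of_nat ((l + i) choose l) * (- 1) ^ i) * (T i $ M * of_nat p ^ i)"
      unfolding K_def by (subst power_minus) (simp add: mult_ac)
    also have "pdvd (e + i) \<dots>"
      by (intro pdvd_mult_left[of "of_nat ((l + i) choose l) * (- 1) ^ i"] pdvd_mult that pdvd_p_power
          pdvd_mult_left[of "of_nat ((l + i) choose l)"] pdvd_power) auto
    finally show ?thesis .
  qed
  have pred: "pdvd (D + 1) (K (D - 1))"
  proof -
    \<comment> \<open>Reflection sends degree M of \<open>T (D - 1)\<close> to degree c - 1, where
      the coefficient has the factor p^2; with p^(D-1) from the expansion this makes
      p^(D+1).\<close>
    have "fps_pdvd (c - 1) 2 (T (D - 1))"
      unfolding T_def A_def c_def using assms
      by (intro fps_pdvd_mult_left fps_pdvd_one_minus_X_power fps_pdvd_binomial_fps_power) auto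
    then have "pdvd 2 (T (D - 1) $ (c - 1))" by (simp add: fps_pdvd_def)
    then have "pdvd 2 ((- 1) ^ (c - 1) * \<epsilon> ^ (D - 1) * T (D - 1) $ (c - 1))"
      by (intro pdvd_mult_left[of "_ * _"] pdvd_mult_left[of "(- 1) ^ (c - 1)"] pdvd_power) (auto simp: \<epsilon>_def intro: pdvd_power)
    then have "pdvd 2 (T (D - 1) $ M)"
      using nth[of "c - 1" "D - 1"] by (simp add: M_def)
    then show ?thesis using pK[of 2 "D - 1"] assms by simp
  qed
  have main: "K D = of_nat p ^ D * (of_nat (n choose l) * (- 1) ^ D *
      ((- 1) ^ (c - 1) * \<epsilon> ^ D * T D $ (c - 1 + q)))"
  proof -
    \<comment> \<open>For i = D the reflection sends degree M to c - 1 + q.\<close>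
    have "q \<le> q * D" using assms by simp
    then have "M = (c - 1) + q * D - (c - 1 + q)" by (simp add: M_def diff_mult_distrib2)
    then have "T D $ M = (- 1) ^ (c - 1) * \<epsilon> ^ D * T D $ (c - 1 + q)"
      using nth[of "c - 1 + q" D] \<open>q \<le> q * D\<close> by simp
    then show ?thesis
      unfolding K_def assms(6) by (subst power_minus) (simp add: mult_ac)
  qed
  \<comment> \<open>Ensures that i = D lies in the range of summation, by D \<ge> 2 and q \<ge>
    2.\<close>
  have "D \<le> 2 * (D - 1)" using assms by simp
  also have "2 \<le> q" using \<open>a > 0\<close> prime_ge_2_nat[OF prime] by (metis q_def order.trans self_le_power prime_ge_1_nat prime)
  then have "2 * (D - 1) \<le> M" unfolding M_def by (intro mult_le_mono1)
  finally have "(\<Sum>i\<le>M. K i) - K D = (\<Sum>i\<in>{..M} - {D}. K i)"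
    by (subst sum.remove[of _ D]) auto
  also have "pdvd (D + 1) \<dots>"
  proof (rule pdvd_sum)
    fix i assume "i \<in> {..M} - {D}"
    then consider "i + 2 \<le> D" | "i = D - 1" | "D + 1 \<le> i" by force
    then show "pdvd (D + 1) (K i)"
    proof cases
      case 3
      have "pdvd (0 + i) (K i)"
        using fps_pdvdD[OF intT[of M i]] by (intro pK) simp
      then show ?thesis using 3 by (auto intro: pdvd_le)
    qed (use small pred in auto)
  qed
  finally have "pdvd (D + 1) (\<epsilon> ^ (l + 1) * ((\<Sum>i\<le>M. K i) - K D))"
    by (intro pdvd_mult_left pdvd_power) (auto simp: \<epsilon>_def intro: pdvd_power)
  also have "\<epsilon> ^ (l + 1) * ((\<Sum>i\<le>M. K i) - K D) = \<epsilon> ^ (l + 1) * (\<Sum>i\<le>M. K i)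
     - of_nat p ^ D * (of_nat (n choose l) * \<epsilon> ^ (l + 1) * (- 1) ^ D *
      ((- 1) ^ (c - 1) * \<epsilon> ^ D * T D $ (c - 1 + q)))"
    unfolding main by (simp only: right_diff_distrib mult_ac)
  finally show ?thesis
    unfolding q_def[symmetric] \<epsilon>_def[symmetric] A_def[symmetric] T_def[symmetric] S .
qed

section \<open>From the truncated logarithm to Bernoulli numbers\<close>

text \<open>After x^D is split off, only degrees up to m + p - D \<le> p - 2 matter, and there the
  truncation of the logarithm is not visible.\<close>

lemma log_fps_power_nth:
  assumes "D \<ge> m + 2" "D \<le> m + p"
  shows "((1 - fps_X) ^ m * log_fps ^ D) $ (m + p)
       = ((1 - fps_X) ^ m * Abs_fps (\<lambda>k. 1 / of_nat (k + 1)) ^ D) $ (m + p - D)"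
proof -
  define T :: "rat fps" where "T = fps_shift 1 log_fps"
  have "log_fps = fps_X * T"
    by (rule fps_ext) (simp add: T_def log_fps_def fps_X_mult_nth)
  then have "(1 - fps_X) ^ m * log_fps ^ D = fps_X ^ D * ((1 - fps_X) ^ m * T ^ D)"
    by (simp add: power_mult_distrib mult_ac)
  moreover have "\<not> m + p < D" using assms by simp
  ultimately have "((1 - fps_X) ^ m * log_fps ^ D) $ (m + p) = ((1 - fps_X) ^ m * T ^ D) $ (m + p - D)"
    by (simp only: fps_X_power_mult_nth if_False)
  also have "\<dots> = ((1 - fps_X) ^ m * Abs_fps (\<lambda>k. 1 / of_nat (k + 1)) ^ D) $ (m + p - D)"
  proof -
    have "(T ^ D) $ j = (Abs_fps (\<lambda>k. 1 / of_nat (k + 1)) ^ D) $ j" if "j \<le> m + p - D" for j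
      by (rule fps_power_nth_cong[OF _ that]) (use assms in \<open>simp add: T_def log_fps_def\<close>)
    then show ?thesis by (simp add: fps_mult_nth)
  qed
  finally show ?thesis .
qed

text \<open>With E = m + p - D, Lagrange inversion produces the exponent D + E + 1 = (m + 1) + p of
  1/\<psi>. The first m + 1 factors combine with the exponential to
  \<open>bernoulli_fps ^ (m + 1)\<close>; the remaining p-th power is 1 modulo \<open>p\<close> in
  degrees below \<open>p\<close>.\<close>

lemma bernoulli_fps_power_cong:
  assumes "D \<ge> m + 2" "D \<le> m + p"
  shows "pdvd 1 (((1 - fps_X) ^ m * log_fps ^ D) $ (m + p) - (bernoulli_fps ^ (m + 1)) $ (m + p - D))"
    and "pdvd 0 ((bernoulli_fps ^ (m + 1)) $ (m + p - D))"
proof -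
  define E where "E = m + p - D"
  define \<psi> :: "rat fps" where "\<psi> = Abs_fps (\<lambda>k. (- 1) ^ k / fact (k + 1))"
  \<comment> \<open>The stronger bound is needed for \<psi>, whose coefficient in degree k has
    denominator (k + 1)!.\<close>
  have E: "E < p - 1" "E < p" using assms p_pos by (auto simp: E_def)
  have fact: "pdvd 0 ((- 1) ^ j / fact k)" if "k < p" for j k
  proof -
    have "pdvd 0 ((- 1) ^ j * (1 / of_nat (fact k)))"
      using that prime by (intro pdvd_mult_left pdvd_power pdvd_inverse) (auto simp: prime_dvd_fact_iff)
    then show ?thesis by simp
  qed
  have \<psi>: "fps_pdvd E 0 \<psi>"
    unfolding fps_pdvd_def \<psi>_def using E fact by (auto simp del: fact_Suc)
  have \<psi>0: "\<psi> $ 0 = 1" by (simp add: \<psi>_def)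
  then have inv: "inverse \<psi> * \<psi> = 1" by (metis inverse_mult_eq_1 one_neq_zero)
  have I: "fps_pdvd E 0 (inverse \<psi>)" by (rule fps_pdvd_inverse[OF inv \<psi>0 \<psi>])
  have exp: "fps_pdvd E 0 (fps_exp (- 1))"
    unfolding fps_pdvd_def using E fact by auto
  have B: "bernoulli_fps = fps_exp (- 1) * inverse \<psi>"
  proof -
    have "bernoulli_fps * fps_exp 1 * fps_exp (- 1) = inverse \<psi> * fps_exp (- 1)"
      unfolding \<psi>_def bernoulli_fps_lagrange(2) ..
    moreover have "fps_exp 1 * fps_exp (- 1) = (1 :: rat fps)"
      by (simp flip: fps_exp_add_mult)
    ultimately show ?thesis by (simp only: mult.assoc mult_1_right) (simp only: mult.commute)
  qed
  have Bm: "bernoulli_fps ^ (m + 1) = fps_exp (- of_nat (m + 1)) * inverse \<psi> ^ (m + 1)"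
    by (simp only: B power_mult_distrib fps_exp_power_mult mult_minus1_right)
  have IB: "fps_pdvd E 0 (bernoulli_fps ^ (m + 1))"
    unfolding B by (intro fps_pdvd_power fps_pdvd_mult_left exp I)
  then show "pdvd 0 ((bernoulli_fps ^ (m + 1)) $ (m + p - D))"
    by (simp add: fps_pdvd_def E_def)
  have "((1 - fps_X) ^ m * log_fps ^ D) $ (m + p) = (fps_exp (- of_nat (m + 1)) * inverse \<psi> ^ (D + E + 1)) $ E"
    unfolding log_fps_power_nth[OF assms] E_def[symmetric] \<psi>_def bernoulli_fps_lagrange(1) ..
  also have "D + E + 1 = (m + 1) + p" using assms by (simp add: E_def)
  also have "fps_exp (- of_nat (m + 1)) * inverse \<psi> ^ ((m + 1) + p) = bernoulli_fps ^ (m + 1) * inverse \<psi> ^ p"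
    by (simp only: Bm power_add[of _ _ p] mult.assoc)
  finally have L: "((1 - fps_X) ^ m * log_fps ^ D) $ (m + p) = (bernoulli_fps ^ (m + 1) * inverse \<psi> ^ p) $ E" .
  have "fps_pdvd E 1 (bernoulli_fps ^ (m + 1) * (inverse \<psi> ^ p - 1))"
    using E \<psi>0 by (intro fps_pdvd_mult_left IB fps_power_prime_cong_one I) auto
  then have "pdvd 1 ((bernoulli_fps ^ (m + 1) * (inverse \<psi> ^ p - 1)) $ E)"
    by (rule fps_pdvdD) simp
  then show "pdvd 1 (((1 - fps_X) ^ m * log_fps ^ D) $ (m + p) - (bernoulli_fps ^ (m + 1)) $ (m + p - D))"
    unfolding L E_def[symmetric] by (simp only: right_diff_distrib mult_1_right fps_sub_nth)
qed

text \<open>The product times binom(p - 1, j - 1) is (p - 1)!, which is -1 by Wilson's theorem, and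
  the binomial coefficient is (-1)^(j-1) modulo \<open>p\<close>.\<close>

lemma wilson_fact_cong:
  assumes "1 \<le> j" "j \<le> p"
  shows "pdvd 1 (fact (j - 1) * fact (p - j) - (- 1) ^ j)"
proof -
  define x :: rat where "x = fact (j - 1) * fact (p - j)"
  have x: "pdvd 0 x"
    unfolding x_def by (intro pdvd_mult_left) (metis of_nat_fact pdvd_0_of_int(2))+
  have "p - 1 - (j - 1) = p - j" using assms by simp
  then have "fact (j - 1) * fact (p - j) * (p - 1 choose (j - 1)) = fact (p - 1)"
    using binomial_fact_lemma[of "j - 1" "p - 1"] assms by simp
  then have f: "x * of_nat (p - 1 choose (j - 1)) = fact (p - 1)"
    unfolding x_def by (metis of_nat_fact of_nat_mult)
  have "[fact (p - 1) = - 1] (mod int p)"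
    using wilson_theorem[OF prime] .
  then have "int p dvd fact (p - 1) + 1"
    by (simp add: cong_iff_dvd_diff)
  then have 1: "pdvd 1 (fact (p - 1) + 1)"
    using pdvd_of_int[of 1 "fact (p - 1) + 1"] by simp
  have "pdvd 1 (of_nat (p - 1 choose (j - 1)) - (- 1) ^ (j - 1))"
    using binomial_prime_power_minus_one_cong[of "j - 1" 1] assms by simp
  then have "pdvd 1 (x * (of_nat (p - 1 choose (j - 1)) - (- 1) ^ (j - 1)))"
    by (rule pdvd_mult_left[OF x])
  then have "pdvd 1 (fact (p - 1) + 1 - (fact (p - 1) - x * (- 1) ^ (j - 1)))"
    by (intro pdvd_diff[OF 1]) (simp only: right_diff_distrib f)
  then have "pdvd 1 (x * (- 1) ^ (j - 1) + 1)"
    by (simp add: algebra_simps)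
  then have "pdvd 1 ((- 1) ^ (j - 1) * (x * (- 1) ^ (j - 1) + 1))"
    by (intro pdvd_mult_left pdvd_power) auto
  also have "(- 1) ^ (j - 1) * (x * (- 1) ^ (j - 1) + 1) = x * ((- 1) ^ (j - 1) * (- 1) ^ (j - 1)) + (- 1) ^ (j - 1)"
    by (simp add: algebra_simps)
  also have "(- 1) ^ (j - 1) * (- 1) ^ (j - 1) = (1 :: rat)"
    by (simp flip: power_mult_distrib)
  also have "x * 1 + (- 1) ^ (j - 1) = x - (- 1) ^ j"
    using assms by (cases j) simp_all
  finally show ?thesis by (simp add: x_def)
qed

end

section \<open>Assembly of the congruence\<close>

text \<open>The product is the falling factorial D(D - 1)...(D - m) = D!/(D - m - 1)!, and n!/l! =
  binom(n, l) D!.\<close>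

lemma fact_div_fact_div_prod:
  assumes "n = l + D" "m < D"
  shows "fact n / fact l / (\<Prod>k=0..m. of_int (int n - int l - int k))
       = (of_nat (n choose l) * fact (D - m - 1) :: rat)"
proof -
  have "(\<Prod>k=0..m. of_int (int n - int l - int k)) * fact (D - m - 1) = (fact D :: rat)"
    using \<open>m < D\<close>
  proof (induction m)
    case 0
    then show ?case by (cases D) (simp_all add: assms(1))
  next
    case (Suc m)
    then obtain r where r: "D = Suc (Suc m) + r" by (auto simp: less_iff_Suc_add)
    then have "fact (D - m - 1) = (of_int (int n - int l - int (Suc m)) * fact (D - Suc m - 1) :: rat)"
      by (simp add: assms(1))
    then show ?case using Suc by (simp add: mult_ac)
  qed
  moreover have "fact n = (fact l * fact D * of_nat (n choose l) :: rat)"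
    using binomial_fact_lemma[of l n] assms(1)
    by (metis add_diff_cancel_left' le_add1 of_nat_fact of_nat_mult)
  moreover have "fact D \<noteq> (0 :: rat)" by simp
  moreover have "(fact l :: rat) \<noteq> 0" by simp
  moreover have "(\<Prod>k=0..m. of_int (int n - int l - int k)) \<noteq> (0 :: rat)"
    using calculation(1,3) by (metis mult_zero_left)
  ultimately show ?thesis
    by (simp add: divide_eq_eq mult_ac)
qed

theorem theorem1p4:
  fixes p a l m n d :: nat
  assumes "prime p"
    and "a > 0"
    and "m < p"
    and "2 \<le> int n - int l - int m"
    and "int n - int l - int m \<le> int p"
    and "d \<in> {1..max (p ^ (a - 2)) 1}"
  shows "rat_cong
    (1 / of_nat p ^ (n - l) *
      (\<Sum>k\<in>{l<..n}.
         of_nat ((p ^ a * n - p ^ (a - 1) * m - d) choose (p ^ a * k - p ^ (a - 1) * m - d)) *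
         (- 1) ^ (p * k) * of_nat ((k - 1) choose l)))
    (((- 1) powi (int l - 1) * (fact n / fact l)) /
       (\<Prod>k=0..m. of_int (int n - int l - int k)) *
       bernoulli_higher (m + 1) (p + l + m - n))
    p"
proof -
  interpret padic p by standard fact
  define D where "D = n - l"
  have n: "n = l + D" and D: "D \<ge> m + 2" "D \<le> m + p"
    using assms(4,5) by (auto simp: D_def)
  \<comment> \<open>For a = 1 truncated subtraction gives \<open>p ^ (a - 2) = 1\<close>, so the
    maximum is \<open>p ^ (a - 2)\<close> in every case.\<close>
  have d: "1 \<le> d" "d \<le> p ^ (a - 2)"
    using assms(6) by (simp_all add: max_absorb1 Suc_le_eq)
  have "p ^ (a - 2) \<le> p ^ (a - 1)"
    by (intro power_increasing) (auto simp: Suc_le_eq)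
  then have d': "d \<le> p ^ (a - 1)" using d by simp
  define c where "c = p ^ (a - 1) * m + d"
  define \<epsilon> :: rat where "\<epsilon> = (- 1) ^ p"
  define \<kappa> where "\<kappa> = ((1 - fps_X) ^ (c - 1) * binomial_fps a ^ D) $ (c - 1 + p ^ a)"
  define \<beta> where "\<beta> = (bernoulli_fps ^ (m + 1)) $ (m + p - D)"
  define S :: rat where "S = (\<Sum>k\<in>{l<..n}. of_nat ((p ^ a * n - c) choose (p ^ a * k - c)) * \<epsilon> ^ k * of_nat ((k - 1) choose l))"
  define x :: rat where "x = of_nat (n choose l) * \<epsilon> ^ (l + 1) * (- 1) ^ D * ((- 1) ^ (c - 1) * \<epsilon> ^ D)"
  have "pdvd (D + 1) (S - of_nat p ^ D * (x * \<kappa>))"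
    using binomial_sum_cong[OF assms(2,3) d n D(1)]
    unfolding S_def x_def \<kappa>_def \<epsilon>_def c_def by (simp only: mult.assoc)
  moreover have "S - of_nat p ^ D * (x * \<kappa>) = of_nat p ^ D * (1 / of_nat p ^ D * S - x * \<kappa>)"
    by (simp add: right_diff_distrib)
  ultimately have 1: "pdvd 1 (1 / of_nat p ^ D * S - x * \<kappa>)"
    by (simp only: pdvd_cancel_p_power)
  have ints: "pdvd 0 \<epsilon>" "pdvd 0 x"
  proof -
    show "pdvd 0 \<epsilon>" unfolding \<epsilon>_def by (intro pdvd_power) simp
    then show "pdvd 0 x" unfolding x_def by (intro pdvd_mult_left pdvd_power) simp_all
  qed
  have \<beta>0: "pdvd 0 \<beta>" unfolding \<beta>_def by (rule bernoulli_fps_power_cong(2)[OF D])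
  have "pdvd 1 (\<kappa> - (- 1) ^ (d - 1) * (- 1) ^ D * ((1 - fps_X) ^ m * log_fps ^ D) $ (m + p))"
    unfolding \<kappa>_def c_def by (rule binomial_fps_power_nth_cong[OF assms(2) d(1) d'])
  moreover have "pdvd 1 ((- 1) ^ (d - 1) * (- 1) ^ D * ((1 - fps_X) ^ m * log_fps ^ D) $ (m + p)
      - (- 1) ^ (d - 1) * (- 1) ^ D * \<beta>)"
    unfolding right_diff_distrib[symmetric] mult.assoc \<beta>_def
    by (intro pdvd_mult_left pdvd_power bernoulli_fps_power_cong(1)[OF D]) simp_all
  ultimately have "pdvd 1 (\<kappa> - (- 1) ^ (d - 1) * (- 1) ^ D * \<beta>)"
    by (rule pdvd_trans)
  then have "pdvd 1 (x * (\<kappa> - (- 1) ^ (d - 1) * (- 1) ^ D * \<beta>))"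
    by (intro pdvd_mult_left ints)
  then have 2: "pdvd 1 (x * \<kappa> - x * ((- 1) ^ (d - 1) * (- 1) ^ D * \<beta>))"
    by (simp only: right_diff_distrib)
  \<comment> \<open>The sign belonging to the part \<open>p ^ (a - 1) * m\<close> of the exponent
    \<open>c - 1\<close>; for p = 2 it may be 1, so it is replaced by -1 only modulo
    \<open>p\<close>.\<close>
  define \<delta> :: rat where "\<delta> = (- 1) ^ (p ^ (a - 1))"
  have "(- 1) ^ (c - 1) = \<delta> ^ m * (- 1) ^ (d - 1)"
    using d by (simp add: \<delta>_def c_def flip: power_mult power_add)
  then have "x * ((- 1) ^ (d - 1) * (- 1) ^ D * \<beta>)
      = of_nat (n choose l) * (\<epsilon> ^ (l + 1 + D) * \<delta> ^ m) * \<beta>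
          * ((- 1) ^ (d - 1) * (- 1) ^ (d - 1)) * ((- 1) ^ D * (- 1) ^ D)"
    unfolding x_def power_add by (simp only: mult_ac)
  also have "\<dots> = of_nat (n choose l) * \<beta> * (\<epsilon> ^ (l + 1 + D) * \<delta> ^ m)"
    by (simp flip: power_mult_distrib)
  finally have x: "x * ((- 1) ^ (d - 1) * (- 1) ^ D * \<beta>) = of_nat (n choose l) * \<beta> * (\<epsilon> ^ (l + 1 + D) * \<delta> ^ m)" .
  have \<epsilon>: "pdvd 1 (\<epsilon> - (- 1))" and \<delta>: "pdvd 1 (\<delta> - (- 1))"
    using neg_one_power_cong[of 1] neg_one_power_cong[of "a - 1"] by (simp_all add: \<epsilon>_def \<delta>_def)
  have "pdvd 0 \<delta>" unfolding \<delta>_def by (intro pdvd_power) simp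
  then have "pdvd 1 (\<epsilon> ^ (l + 1 + D) * \<delta> ^ m - (- 1) ^ (l + 1 + D) * (- 1) ^ m)"
    using ints by (intro pdvd_mult_cong pdvd_power_cong \<epsilon> \<delta> pdvd_power) simp_all
  then have "pdvd 1 (of_nat (n choose l) * \<beta> * (\<epsilon> ^ (l + 1 + D) * \<delta> ^ m - (- 1) ^ (l + 1 + D) * (- 1) ^ m))"
    by (intro pdvd_mult_left[of "_ * _"] pdvd_mult_left[of "of_nat (n choose l)"] \<beta>0) simp_all
  then have 3: "pdvd 1 (x * ((- 1) ^ (d - 1) * (- 1) ^ D * \<beta>)
      - of_nat (n choose l) * \<beta> * ((- 1) ^ (l + 1 + D) * (- 1) ^ m))"
    unfolding x by (simp only: right_diff_distrib)
  \<comment> \<open>With this \<open>j\<close> the Bernoulli index is p - j and the factorial from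
    the product is (j - 1)!. Wilson's theorem then trades the sign (-1)^j for (j - 1)! (p - j)!,
    whose second factor turns the coefficient \<beta> into a Bernoulli number.\<close>
  define j where "j = D - m"
  have j: "1 \<le> j" "j \<le> p" "D = m + j" using D by (auto simp: j_def)
  have "pdvd 1 (of_nat (n choose l) * \<beta> * (- 1) ^ (l + 1) * ((- 1) ^ j - fact (j - 1) * fact (p - j)))"
    by (intro pdvd_mult_left[of "_ * _"] pdvd_mult_left[of "of_nat (n choose l)"] \<beta>0 pdvd_power
        pdvd_diff_commute[OF wilson_fact_cong[OF j(1,2)]]) simp_all
  moreover have "(- 1) ^ (l + 1 + D) * (- 1) ^ m = (- 1) ^ (l + 1) * ((- 1) ^ j :: rat)"
  proof -
    have "(- 1) ^ m * (- 1) ^ m = (1 :: rat)" by (simp flip: power_mult_distrib)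
    then show ?thesis unfolding j(3) by (simp add: power_add)
  qed
  ultimately have 4: "pdvd 1 (of_nat (n choose l) * \<beta> * ((- 1) ^ (l + 1 + D) * (- 1) ^ m)
      - of_nat (n choose l) * \<beta> * (- 1) ^ (l + 1) * (fact (j - 1) * fact (p - j)))"
    by (simp only: right_diff_distrib mult.assoc)
  \<comment> \<open>The exponent is -1 for l = 0; it always has the parity of l + 1.\<close>
  have "(- 1) powi (int l - 1) = ((- 1) ^ (l + 1) :: rat)"
    by (cases l) (simp_all add: power_int_def nat_diff_distrib)
  then have "((- 1) powi (int l - 1) * (fact n / fact l)) /
       (\<Prod>k=0..m. of_int (int n - int l - int k)) * bernoulli_higher (m + 1) (p + l + m - n)
      = (- 1) ^ (l + 1) * (fact n / fact l / (\<Prod>k=0..m. of_int (int n - int l - int k)))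
          * (fact (p - j) * \<beta>)"
    using j by (simp add: bernoulli_higher_def \<beta>_def n add.commute)
  also have "\<dots> = of_nat (n choose l) * \<beta> * (- 1) ^ (l + 1) * (fact (j - 1) * fact (p - j))"
    using D by (subst fact_div_fact_div_prod[OF n]) (simp_all add: j_def mult_ac)
  finally have R: "((- 1) powi (int l - 1) * (fact n / fact l)) /
       (\<Prod>k=0..m. of_int (int n - int l - int k)) * bernoulli_higher (m + 1) (p + l + m - n)
      = of_nat (n choose l) * \<beta> * (- 1) ^ (l + 1) * (fact (j - 1) * fact (p - j))" .
  have "pdvd 1 (1 / of_nat p ^ D * S - of_nat (n choose l) * \<beta> * (- 1) ^ (l + 1) * (fact (j - 1) * fact (p - j)))"
    using pdvd_trans[OF pdvd_trans[OF pdvd_trans[OF 1 2] 3] 4] .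
  then show ?thesis
    unfolding rat_cong_iff R S_def D_def c_def \<epsilon>_def by (simp only: power_mult diff_diff_left)
qed

end
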